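(* Let $P$ be a robustly typed, input-linear program with input selectability and $p$ a predicate in $P$. Suppose all predicates $q$ with $p\sqsupset q$ are robust, and all clauses defining predicates $q$ with $q\approx p$ are well-recurrent with respect to some (one and the same) moded typed level mapping $|.|$. Then $p$ is robust.
   Context: Basics. A query is a finite sequence of atoms; a clause is $h\leftarrow B$ with $h$ an atom and $B$ a query. Every predicate has a fixed mode, i.e. each argument position is either input or output; $p(\mathbf s,\mathbf t)$ denotes an atom with $\mathbf s$ (resp. $\mathbf t$) the vector of terms filling the input (resp. output) positions. In clause heads $p(\mathbf t_0,\mathbf s_{n+1})$, $\mathbf t_0$ is the input and $\mathbf s_{n+1}$ the output. A syntactic object is linear if each variable occurs in it at most once. A clause is input-linear if the vector of input terms of its head is linear; a program is input-linear if all its clauses are and it does not use the equality predicate $=$ with both arguments input. A flat term is a variable or a term $f(x_1,\dots,x_n)$, $n\ge 0$, with distinct variables $x_i$. Types. A type is a non-empty set of terms closed under instantiation. The variable type is the type of all terms; any other type is a non-variable type. Each argument position of each predicate has an associated type. $t:T$ means $t\in T$ (componentwise for vectors); an atom is correctly typed in a position if the term there belongs to the type of the position. $\models \varphi\Rightarrow \mathbf t:\mathbf T$ means that the implication holds after applying any substitution to all terms. A term is type-consistent (in a position of type $T$) if some instance of it is in $T$. Nicely moded. $Q=p_1(\mathbf s_1,\mathbf t_1),\dots,p_n(\mathbf s_n,\mathbf t_n)$ is nicely moded if $\mathbf t_1,\dots,\mathbf t_n$ is linear and for all $i$, $vars(\mathbf s_i)\cap\bigcup_{i\le j\le n}vars(\mathbf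 t_j)=\emptyset$. A clause $p(\mathbf t_0,\mathbf s_{n+1})\leftarrow Q$ is nicely moded if $Q$ is and $vars(\mathbf t_0)\cap\bigcup_{j=1}^n vars(\mathbf t_j)=\emptyset$. Well typed. With $p_i(\mathbf S_i,\mathbf T_i)$ the type of $p_i$, $Q$ is well typed if for all $i\in\{1,\dots,n\}$, $\models(\bigwedge_{1\le j<i}\mathbf t_j:\mathbf T_j)\Rightarrow\mathbf s_i:\mathbf S_i$. A clause $p(\mathbf t_0,\mathbf s_{n+1})\leftarrow Q$, with $p(\mathbf T_0,\mathbf S_{n+1})$ the type of $p$, is well typed if for all $i\in\{1,\dots,n+1\}$, $\models(\bigwedge_{0\le j<i}\mathbf t_j:\mathbf T_j)\Rightarrow\mathbf s_i:\mathbf S_i$. Bound/free (relative to a well typed program $P$). An input position of $p$ is bound if some clause head $p(\dots)$ in $P$ has a non-variable term there; an output position of $p$ is bound if some body atom $p(\dots)$ in $P$ has a non-variable term there; otherwise the position is free. $\mathbf r^{\sf f},\mathbf r^{\sf b}$ are the projections of $\mathbf r$ onto its free/bound positions. Robustly typed (relative to a well typed program $P$ whose bound positions are of non-variable type). $Q$ is robustly typed if it is nicely moded and well typed, $\mathbf t_1^{\sf f},\dots,\mathbf t_n^{\sf f}$ is a vector of variables and $\mathbf t_1^{\sf b},\dots,\mathbf t_n^{\sf b}$ a vector of flat type-consistent terms. A clause $p(\mathbf t_0,\mathbf s_{n+1})\leftarrow Q$ is robustly typed if it is nicely moded and well typed; $\mathbf t_0^{\sf f},\dots,\mathbf t_n^{\sf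 f}$ is a vector of variables and $\mathbf t_0^{\sf b},\dots,\mathbf t_n^{\sf b}$ a vector of flat type-consistent terms; and if a position of type $\tau$ in $\mathbf s_{n+1}^{\sf b}$ is filled with a variable $x$, then $x$ also fills a position of type $\tau$ in $\mathbf t_0^{\sf b},\dots,\mathbf t_n^{\sf b}$. A program is robustly typed if all its clauses are. Derivations. A program consists of clauses and, for each predicate $p/n$, a block declaration: a (possibly empty) set of atoms $p(b_1,\dots,b_n)$ with $b_i\in\{?,-\}$. An atom $p(t_1,\dots,t_n)$ is blocked if for some $p(b_1,\dots,b_n)$ in the declaration, $t_i$ is a variable for all $i$ with $b_i=-$; otherwise it is selectable. In a derivation step a query $Q_1,a,Q_2$ is replaced by $(Q_1,B,Q_2)\theta$, where $h\leftarrow B$ is a variant, renamed apart, of a program clause and $\theta$ is a most general unifier of the selected atom $a$ and $h$. A derivation of $P\cup\{Q\}$ is a (finite or infinite) sequence of such steps starting at $Q$; it is delay-respecting if the selected atom is always selectable. Input selectability. $P$ has input selectability if every atom (using a predicate of $P$) that has variables in all free output positions is selectable in $P$ (1) only if it is non-variable in all bound input positions, and (2) if it is non-variable in all input positions of non-variable type. Robust. A predicate $p$ in $P$ is robust if for each robustly typed query $p(\mathbf s,\mathbf t)$ consisting of one atom, every delay-respecting derivation of $P\cup\{p(\mathbf s,\mathbf t)\}$ is finite. Depends on. $p$ refers to $q$ if some clause of $P$ has $p$ in its head and $q$ in its body; $p\sqsupseteq q$ is the reflexive transitive closure of this relation; $p\sqsupset q$ means $p\sqsupseteq q$ and $q\not\sqsupseteq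 p$; $p\approx q$ means $p\sqsupseteq q$ and $q\sqsupseteq p$. The same symbols are used for atoms, referring to their predicates. Level mappings. Let $\mathbf B_P^{Inp}$ be the set of atoms using predicates occurring in $P$ that are correctly typed in their input positions. A function $|.|:\mathbf B_P^{Inp}\to\mathbb N$ is a moded typed level mapping if for each $p(\mathbf s,\mathbf t)\in\mathbf B_P^{Inp}$: $|p(\mathbf s,\mathbf t)|=|p(\mathbf s,\mathbf u)|$ for any $\mathbf u$, and $|p(\mathbf s,\mathbf t)|=|p(\mathbf s\theta,\mathbf t)|$ for any substitution $\theta$. Well-recurrent. A clause $h\leftarrow B$ is well-recurrent with respect to $|.|$ if for every $a$ in $B$ with $a\approx h$ and every substitution $\theta$ such that $a\theta,h\theta\in\mathbf B_P^{Inp}$, we have $|h\theta|>|a\theta|$. *)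

theory Defs
  imports Main "HOL-Library.Infinite_Typeclass"
begin

(* As usual in Isabelle developments on first-order terms, a function symbol is a name together
   with the number of its arguments, and a substitution is any function from variables to terms. *)

datatype ('f, 'v) trm = Var 'v | Fun 'f "('f, 'v) trm list"

type_synonym ('f, 'v) subst = "'v \<Rightarrow> ('f, 'v) trm"

fun subst_trm :: "('f, 'v) trm \<Rightarrow> ('f, 'v) subst \<Rightarrow> ('f, 'v) trm" (infixl "\<cdot>" 67) where
  "Var x \<cdot> \<sigma> = \<sigma> x"
| "Fun f ts \<cdot> \<sigma> = Fun f (map (\<lambda>t. t \<cdot> \<sigma>) ts)"

definition subst_comp :: "('f, 'v) subst \<Rightarrow> ('f, 'v) subst \<Rightarrow> ('f, 'v) subst" where
  "subst_comp \<sigma> \<rho> = (\<lambda>x. \<sigma> x \<cdot> \<rho>)"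

fun is_variable :: "('f, 'v) trm \<Rightarrow> bool" where
  "is_variable (Var x) = True"
| "is_variable (Fun f ts) = False"

fun occs :: "('f, 'v) trm \<Rightarrow> 'v list" where
  "occs (Var x) = [x]"
| "occs (Fun f ts) = concat (map occs ts)"

definition occs_list :: "('f, 'v) trm list \<Rightarrow> 'v list" where
  "occs_list ts = concat (map occs ts)"

definition vars_list :: "('f, 'v) trm list \<Rightarrow> 'v set" where
  "vars_list ts = set (occs_list ts)"

definition linear :: "('f, 'v) trm list \<Rightarrow> bool" where
  "linear ts \<longleftrightarrow> distinct (occs_list ts)"

definition flat :: "('f, 'v) trm \<Rightarrow> bool" where
  "flat t \<longleftrightarrow> (\<exists>x. t = Var x) \<or> (\<exists>f xs. distinct xs \<and> t = Fun f (map Var xs))"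

definition is_type :: "('f, 'v) trm set \<Rightarrow> bool" where
  "is_type T \<longleftrightarrow> T \<noteq> {} \<and> (\<forall>t \<in> T. \<forall>\<sigma>. t \<cdot> \<sigma> \<in> T)"

definition variable_type :: "('f, 'v) trm set" where
  "variable_type = UNIV"

definition type_consistent :: "('f, 'v) trm \<Rightarrow> ('f, 'v) trm set \<Rightarrow> bool" where
  "type_consistent t T \<longleftrightarrow> (\<exists>\<sigma>. t \<cdot> \<sigma> \<in> T)"

text \<open>\<open>Equality\<close> is the predicate \<open>=\<close>. It has no implicit clause: like any
  other predicate, it is resolved only with the clauses of the program.\<close>

datatype 'p predsym = Equality | Pred 'p

datatype ('f, 'v, 'p) atom = Atom (pred: "'p predsym") (args: "('f, 'v) trm list")

type_synonym ('f, 'v, 'p) query = "('f, 'v, 'p) atom list"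

datatype ('f, 'v, 'p) clause = Clause (head: "('f, 'v, 'p) atom") (body: "('f, 'v, 'p) query")

datatype io = In | Out

text \<open>The arguments \<open>?\<close> and \<open>-\<close> of block declarations.\<close>

datatype block_arg = Any | Dash

text \<open>The modes and types of all predicates are kept together with the clauses and block declarations.
  A type is identified with the set of its terms.\<close>

record ('f, 'v, 'p) program =
  clauses :: "('f, 'v, 'p) clause set"
  modes   :: "'p predsym \<Rightarrow> io list"
  types   :: "'p predsym \<Rightarrow> ('f, 'v) trm set list"
  blocks  :: "'p predsym \<Rightarrow> block_arg list set"

definition arity :: "('f, 'v, 'p) program \<Rightarrow> 'p predsym \<Rightarrow> nat" where
  "arity P q = length (modes P q)"

definition inpos :: "('f, 'v, 'p) program \<Rightarrow> 'p predsym \<Rightarrow> nat set" where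
  "inpos P q = {i. i < arity P q \<and> modes P q ! i = In}"

definition outpos :: "('f, 'v, 'p) program \<Rightarrow> 'p predsym \<Rightarrow> nat set" where
  "outpos P q = {i. i < arity P q \<and> modes P q ! i = Out}"

definition in_args :: "('f, 'v, 'p) program \<Rightarrow> ('f, 'v, 'p) atom \<Rightarrow> ('f, 'v) trm list" where
  "in_args P a = nths (args a) (inpos P (pred a))"

definition out_args :: "('f, 'v, 'p) program \<Rightarrow> ('f, 'v, 'p) atom \<Rightarrow> ('f, 'v) trm list" where
  "out_args P a = nths (args a) (outpos P (pred a))"

definition clause_atoms :: "('f, 'v, 'p) clause \<Rightarrow> ('f, 'v, 'p) atom set" where
  "clause_atoms C = insert (head C) (set (body C))"

definition preds :: "('f, 'v, 'p) program \<Rightarrow> 'p predsym set" where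
  "preds P = (\<Union>C \<in> clauses P. pred ` clause_atoms C)"

definition wf_atom :: "('f, 'v, 'p) program \<Rightarrow> ('f, 'v, 'p) atom \<Rightarrow> bool" where
  "wf_atom P a \<longleftrightarrow> length (args a) = arity P (pred a)"

definition wf_program :: "('f, 'v, 'p) program \<Rightarrow> bool" where
  "wf_program P \<longleftrightarrow>
     finite (clauses P) \<and>
     (\<forall>C \<in> clauses P. \<forall>a \<in> clause_atoms C. wf_atom P a) \<and>
     arity P Equality = 2 \<and>
     (\<forall>q. length (types P q) = arity P q \<and> (\<forall>T \<in> set (types P q). is_type T)) \<and>
     (\<forall>q. \<forall>bs \<in> blocks P q. length bs = arity P q)"

definition subst_atom :: "('f, 'v, 'p) atom \<Rightarrow> ('f, 'v) subst \<Rightarrow> ('f, 'v, 'p) atom"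
    (infixl "\<cdot>a" 67) where
  "a \<cdot>a \<sigma> = Atom (pred a) (map (\<lambda>t. t \<cdot> \<sigma>) (args a))"

definition subst_query :: "('f, 'v, 'p) query \<Rightarrow> ('f, 'v) subst \<Rightarrow> ('f, 'v, 'p) query"
    (infixl "\<cdot>q" 67) where
  "Q \<cdot>q \<sigma> = map (\<lambda>a. a \<cdot>a \<sigma>) Q"

definition vars_query :: "('f, 'v, 'p) query \<Rightarrow> 'v set" where
  "vars_query Q = (\<Union>a \<in> set Q. vars_list (args a))"

definition input_linear_program :: "('f, 'v, 'p) program \<Rightarrow> bool" where
  "input_linear_program P \<longleftrightarrow>
     (\<forall>C \<in> clauses P. linear (in_args P (head C))) \<and>
     \<not> (Equality \<in> preds P \<and> modes P Equality = [In, In])"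

definition nicely_moded_query :: "('f, 'v, 'p) program \<Rightarrow> ('f, 'v, 'p) query \<Rightarrow> bool" where
  "nicely_moded_query P Q \<longleftrightarrow>
     linear (concat (map (out_args P) Q)) \<and>
     (\<forall>i < length Q. vars_list (in_args P (Q ! i)) \<inter>
        (\<Union>j \<in> {i..<length Q}. vars_list (out_args P (Q ! j))) = {})"

definition nicely_moded_clause :: "('f, 'v, 'p) program \<Rightarrow> ('f, 'v, 'p) clause \<Rightarrow> bool" where
  "nicely_moded_clause P C \<longleftrightarrow>
     nicely_moded_query P (body C) \<and>
     vars_list (in_args P (head C)) \<inter> (\<Union>a \<in> set (body C). vars_list (out_args P a)) = {}"

definition typed_in :: "('f, 'v, 'p) program \<Rightarrow> ('f, 'v, 'p) atom \<Rightarrow> bool" where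
  "typed_in P a \<longleftrightarrow> (\<forall>i \<in> inpos P (pred a). args a ! i \<in> types P (pred a) ! i)"

definition typed_out :: "('f, 'v, 'p) program \<Rightarrow> ('f, 'v, 'p) atom \<Rightarrow> bool" where
  "typed_out P a \<longleftrightarrow> (\<forall>i \<in> outpos P (pred a). args a ! i \<in> types P (pred a) ! i)"

definition well_typed_query :: "('f, 'v, 'p) program \<Rightarrow> ('f, 'v, 'p) query \<Rightarrow> bool" where
  "well_typed_query P Q \<longleftrightarrow>
     (\<forall>i < length Q. \<forall>\<sigma>.
        (\<forall>j < i. typed_out P (Q ! j \<cdot>a \<sigma>)) \<longrightarrow> typed_in P (Q ! i \<cdot>a \<sigma>))"

text \<open>In a head, the input positions act as producers and the output positions as consumers.\<close>

definition well_typed_clause :: "('f, 'v, 'p) program \<Rightarrow> ('f, 'v, 'p) clause \<Rightarrow> bool" where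
  "well_typed_clause P C \<longleftrightarrow>
     (\<forall>i < length (body C). \<forall>\<sigma>.
        typed_in P (head C \<cdot>a \<sigma>) \<and> (\<forall>j < i. typed_out P (body C ! j \<cdot>a \<sigma>))
          \<longrightarrow> typed_in P (body C ! i \<cdot>a \<sigma>)) \<and>
     (\<forall>\<sigma>. typed_in P (head C \<cdot>a \<sigma>) \<and> (\<forall>j < length (body C). typed_out P (body C ! j \<cdot>a \<sigma>))
          \<longrightarrow> typed_out P (head C \<cdot>a \<sigma>))"

definition bound_pos :: "('f, 'v, 'p) program \<Rightarrow> 'p predsym \<Rightarrow> nat \<Rightarrow> bool" where
  "bound_pos P q i \<longleftrightarrow>
     (i \<in> inpos P q \<and>
       (\<exists>C \<in> clauses P. pred (head C) = q \<and> \<not> is_variable (args (head C) ! i))) \<or>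
     (i \<in> outpos P q \<and>
       (\<exists>C \<in> clauses P. \<exists>a \<in> set (body C). pred a = q \<and> \<not> is_variable (args a ! i)))"

text \<open>The condition imposed on a producer position: a variable if the position is free,
  a flat type-consistent term if it is bound.\<close>

definition robust_pos :: "('f, 'v, 'p) program \<Rightarrow> ('f, 'v, 'p) atom \<Rightarrow> nat \<Rightarrow> bool" where
  "robust_pos P a i \<longleftrightarrow>
     (if bound_pos P (pred a) i
      then flat (args a ! i) \<and> type_consistent (args a ! i) (types P (pred a) ! i)
      else is_variable (args a ! i))"

definition robustly_typed_query :: "('f, 'v, 'p) program \<Rightarrow> ('f, 'v, 'p) query \<Rightarrow> bool" where
  "robustly_typed_query P Q \<longleftrightarrow>
     nicely_moded_query P Q \<and> well_typed_query P Q \<and>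
     (\<forall>a \<in> set Q. \<forall>i \<in> outpos P (pred a). robust_pos P a i)"

definition robustly_typed_clause :: "('f, 'v, 'p) program \<Rightarrow> ('f, 'v, 'p) clause \<Rightarrow> bool" where
  "robustly_typed_clause P C \<longleftrightarrow>
     nicely_moded_clause P C \<and> well_typed_clause P C \<and>
     (\<forall>i \<in> inpos P (pred (head C)). robust_pos P (head C) i) \<and>
     (\<forall>a \<in> set (body C). \<forall>i \<in> outpos P (pred a). robust_pos P a i) \<and>
     (\<forall>i \<in> outpos P (pred (head C)). \<forall>x.
        bound_pos P (pred (head C)) i \<and> args (head C) ! i = Var x \<longrightarrow>
          (\<exists>k \<in> inpos P (pred (head C)).
             bound_pos P (pred (head C)) k \<and> args (head C) ! k = Var x \<and>
             types P (pred (head C)) ! k = types P (pred (head C)) ! i) \<or>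
          (\<exists>a \<in> set (body C). \<exists>k \<in> outpos P (pred a).
             bound_pos P (pred a) k \<and> args a ! k = Var x \<and>
             types P (pred a) ! k = types P (pred (head C)) ! i))"

text \<open>The first conjunct is the standing assumption under which robust typing is considered;
  well-typedness of the program is part of the second.\<close>

definition robustly_typed_program :: "('f, 'v, 'p) program \<Rightarrow> bool" where
  "robustly_typed_program P \<longleftrightarrow>
     (\<forall>q i. bound_pos P q i \<longrightarrow> types P q ! i \<noteq> variable_type) \<and>
     (\<forall>C \<in> clauses P. robustly_typed_clause P C)"

definition blocked :: "('f, 'v, 'p) program \<Rightarrow> ('f, 'v, 'p) atom \<Rightarrow> bool" where
  "blocked P a \<longleftrightarrow>
     (\<exists>bs \<in> blocks P (pred a). \<forall>i < arity P (pred a). bs ! i = Dash \<longrightarrow> is_variable (args a ! i))"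

definition selectable :: "('f, 'v, 'p) program \<Rightarrow> ('f, 'v, 'p) atom \<Rightarrow> bool" where
  "selectable P a \<longleftrightarrow> \<not> blocked P a"

definition is_mgu :: "('f, 'v) subst \<Rightarrow> ('f, 'v, 'p) atom \<Rightarrow> ('f, 'v, 'p) atom \<Rightarrow> bool" where
  "is_mgu \<theta> a b \<longleftrightarrow>
     a \<cdot>a \<theta> = b \<cdot>a \<theta> \<and> (\<forall>\<sigma>. a \<cdot>a \<sigma> = b \<cdot>a \<sigma> \<longrightarrow> (\<exists>\<rho>. \<sigma> = subst_comp \<theta> \<rho>))"

definition variant_of :: "('f, 'v, 'p) clause \<Rightarrow> ('f, 'v, 'p) clause \<Rightarrow> bool" where
  "variant_of C' C \<longleftrightarrow>
     (\<exists>\<rho> :: 'v \<Rightarrow> 'v. bij \<rho> \<and>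
        C' = Clause (head C \<cdot>a (\<lambda>x. Var (\<rho> x))) (body C \<cdot>q (\<lambda>x. Var (\<rho> x))))"

definition deriv_step ::
  "('f, 'v, 'p) program \<Rightarrow> ('f, 'v, 'p) atom \<Rightarrow> ('f, 'v, 'p) query \<Rightarrow> ('f, 'v, 'p) query \<Rightarrow> bool"
where
  "deriv_step P a Q Q' \<longleftrightarrow>
     (\<exists>Q1 Q2 C h B \<theta>.
        Q = Q1 @ [a] @ Q2 \<and>
        C \<in> clauses P \<and> variant_of (Clause h B) C \<and>
        vars_query (h # B) \<inter> vars_query Q = {} \<and>
        is_mgu \<theta> a h \<and>
        Q' = (Q1 @ B @ Q2) \<cdot>q \<theta>)"

definition infinite_delay_respecting_derivation ::
  "('f, 'v, 'p) program \<Rightarrow> ('f, 'v, 'p) query \<Rightarrow> (nat \<Rightarrow> ('f, 'v, 'p) query) \<Rightarrow> bool" where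
  "infinite_delay_respecting_derivation P Q d \<longleftrightarrow>
     d 0 = Q \<and> (\<forall>i. \<exists>a. selectable P a \<and> deriv_step P a (d i) (d (Suc i)))"

definition input_selectability :: "('f, 'v, 'p) program \<Rightarrow> bool" where
  "input_selectability P \<longleftrightarrow>
     (\<forall>a. wf_atom P a \<and> pred a \<in> preds P \<and>
          (\<forall>i \<in> outpos P (pred a). \<not> bound_pos P (pred a) i \<longrightarrow> is_variable (args a ! i)) \<longrightarrow>
        (selectable P a \<longrightarrow>
           (\<forall>i \<in> inpos P (pred a). bound_pos P (pred a) i \<longrightarrow> \<not> is_variable (args a ! i))) \<and>
        ((\<forall>i \<in> inpos P (pred a).
            types P (pred a) ! i \<noteq> variable_type \<longrightarrow> \<not> is_variable (args a ! i))
           \<longrightarrow> selectable P a))"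

definition robust :: "('f, 'v, 'p) program \<Rightarrow> 'p predsym \<Rightarrow> bool" where
  "robust P q \<longleftrightarrow>
     (\<forall>a. wf_atom P a \<and> pred a = q \<and> robustly_typed_query P [a] \<longrightarrow>
        \<not> (\<exists>d. infinite_delay_respecting_derivation P [a] d))"

definition refers_to :: "('f, 'v, 'p) program \<Rightarrow> 'p predsym \<Rightarrow> 'p predsym \<Rightarrow> bool" where
  "refers_to P q r \<longleftrightarrow> (\<exists>C \<in> clauses P. pred (head C) = q \<and> r \<in> pred ` set (body C))"

definition depends_on :: "('f, 'v, 'p) program \<Rightarrow> 'p predsym \<Rightarrow> 'p predsym \<Rightarrow> bool" where
  "depends_on P = (refers_to P)\<^sup>*\<^sup>*"

definition strictly_depends_on :: "('f, 'v, 'p) program \<Rightarrow> 'p predsym \<Rightarrow> 'p predsym \<Rightarrow> bool" where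
  "strictly_depends_on P q r \<longleftrightarrow> depends_on P q r \<and> \<not> depends_on P r q"

definition mutually_depend :: "('f, 'v, 'p) program \<Rightarrow> 'p predsym \<Rightarrow> 'p predsym \<Rightarrow> bool" where
  "mutually_depend P q r \<longleftrightarrow> depends_on P q r \<and> depends_on P r q"

definition base_inp :: "('f, 'v, 'p) program \<Rightarrow> ('f, 'v, 'p) atom set" where
  "base_inp P = {a. pred a \<in> preds P \<and> wf_atom P a \<and> typed_in P a}"

text \<open>A level mapping is a total function here; only its values on \<open>base_inp P\<close> matter.\<close>

definition moded_typed_level_mapping ::
  "('f, 'v, 'p) program \<Rightarrow> (('f, 'v, 'p) atom \<Rightarrow> nat) \<Rightarrow> bool" where
  "moded_typed_level_mapping P lev \<longleftrightarrow>
     (\<forall>a \<in> base_inp P. \<forall>b. wf_atom P b \<and> pred b = pred a \<longrightarrow>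
        (in_args P b = in_args P a \<longrightarrow> lev a = lev b) \<and>
        (\<forall>\<theta>. in_args P b = map (\<lambda>t. t \<cdot> \<theta>) (in_args P a) \<and> out_args P b = out_args P a
           \<longrightarrow> lev a = lev b))"

definition well_recurrent ::
  "('f, 'v, 'p) program \<Rightarrow> (('f, 'v, 'p) atom \<Rightarrow> nat) \<Rightarrow> ('f, 'v, 'p) clause \<Rightarrow> bool" where
  "well_recurrent P lev C \<longleftrightarrow>
     (\<forall>a \<in> set (body C). mutually_depend P (pred a) (pred (head C)) \<longrightarrow>
        (\<forall>\<theta>. a \<cdot>a \<theta> \<in> base_inp P \<and> head C \<cdot>a \<theta> \<in> base_inp P \<longrightarrow>
           lev (head C \<cdot>a \<theta>) > lev (a \<cdot>a \<theta>)))"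

end

theory Submission
  imports Defs
begin

text \<open>
  In a robustly typed query, resolving an atom with a clause head leaves the input of the atom
  untouched: the selected atom is non-variable in its bound input positions and the input of the head is
  linear and flat, so the input is merely matched. Hence the atoms to the left of the selected one are
  not instantiated, and resolvents stay robustly typed.

  A query \<open>F, G\<close> terminates if \<open>F\<close> does and all instances of \<open>G\<close> that replace the future outputs of
  \<open>F\<close> by correctly typed terms do: a step in \<open>F\<close> decreases \<open>F\<close> and turns \<open>G\<close> into a query with fewer
  such instances, while a step in \<open>G\<close> does not change \<open>F\<close> and can be replayed on any of these instances.
  Such instances exist because the outputs of \<open>F\<close> are type-consistent. Applied to the prefixes of a
  clause body, this reduces termination of an atom to that of correctly typed instances of the body
  atoms, which are either robust or of smaller level.
\<close>

section \<open>Terms and substitutions\<close>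

text \<open>On the input side unification is plain matching, but on the output side it is not: a
  bound output of the selected atom may be a non-variable flat term that faces a variable in the
  head. The last condition of robustly typed clauses settles this case. Such a variable also fills
  either a bound input of the head, where matching replaces it by a non-variable term, or a bound
  output of a body atom at a position of the same type, which may then receive the flat term.

  The second obstacle is interleaving: a consumer may be selected before its producers are finished,
  while termination of its predicate is known only for well typed one-atom queries. Running the
  consumer on hypothetical typed inputs loses no step, because instantiation never blocks an atom
  and a step binds only outputs of the selected atom and variables of the clause.

  Finally, a derivation may use any mgu, even one that renames unrelated variables. Steps are
  therefore first normalised, up to a bijective renaming, to an idempotent mgu with controlled
  domain and range.\<close>

lemma subst_trm_cong_iff: "t \<cdot> \<sigma> = t \<cdot> \<tau> \<longleftrightarrow> (\<forall>x \<in> set (occs t). \<sigma> x = \<tau> x)"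
  by (induction t) auto

lemma subst_trm_comp: "t \<cdot> subst_comp \<sigma> \<tau> = t \<cdot> \<sigma> \<cdot> \<tau>"
  by (induction t) (auto simp: subst_comp_def)

lemma subst_trm_Var: "t \<cdot> Var = t"
  by (induction t) (auto intro: map_idI)

lemma subst_trm_id: "\<forall>x \<in> set (occs t). \<sigma> x = Var x \<Longrightarrow> t \<cdot> \<sigma> = t"
  using subst_trm_cong_iff[of t \<sigma> Var] by (simp add: subst_trm_Var)

lemma subst_trm_absorb: "(\<And>x. \<sigma> x \<cdot> \<tau> = \<tau> x) \<Longrightarrow> t \<cdot> \<sigma> \<cdot> \<tau> = t \<cdot> \<tau>"
  by (simp add: subst_trm_comp[symmetric] subst_trm_cong_iff subst_comp_def)

lemma occs_subst: "occs (t \<cdot> \<sigma>) = concat (map (\<lambda>x. occs (\<sigma> x)) (occs t))"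
proof (induction t)
  case (Fun f ts)
  then show ?case by (induction ts) auto
qed simp

lemma is_variable_iff: "is_variable t \<longleftrightarrow> (\<exists>x. t = Var x)"
  by (cases t) auto

lemma not_is_variable_subst: "\<not> is_variable t \<Longrightarrow> \<not> is_variable (t \<cdot> \<sigma>)"
  by (cases t) auto

lemma vars_list_eq: "vars_list ts = (\<Union>t \<in> set ts. set (occs t))"
  by (simp add: vars_list_def occs_list_def)

lemma finite_vars_list: "finite (vars_list ts)"
  by (simp add: vars_list_def)

lemma occs_list_simps [simp]:
  "occs_list [] = []" "occs_list (t # ts) = occs t @ occs_list ts"
  "occs_list (ts @ us) = occs_list ts @ occs_list us"
  by (simp_all add: occs_list_def)

lemma occs_list_subst:
  "occs_list (map (\<lambda>t. t \<cdot> \<sigma>) ts) = concat (map (\<lambda>x. occs (\<sigma> x)) (occs_list ts))"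
  by (induction ts) (simp_all add: occs_subst)

lemma map_subst_cong_iff:
  "map (\<lambda>t. t \<cdot> \<sigma>) ts = map (\<lambda>t. t \<cdot> \<tau>) ts \<longleftrightarrow> (\<forall>x \<in> vars_list ts. \<sigma> x = \<tau> x)"
  by (auto simp: vars_list_eq subst_trm_cong_iff)

lemma vars_list_subst:
  "vars_list (map (\<lambda>t. t \<cdot> \<sigma>) ts) = (\<Union>x \<in> vars_list ts. set (occs (\<sigma> x)))"
  by (auto simp: vars_list_eq occs_subst)

lemma distinct_concat_map:
  assumes "distinct xs" "\<And>x. x \<in> set xs \<Longrightarrow> distinct (f x)"
    "\<And>x y. x \<in> set xs \<Longrightarrow> y \<in> set xs \<Longrightarrow> x \<noteq> y \<Longrightarrow> set (f x) \<inter> set (f y) = {}"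
  shows "distinct (concat (map f xs))"
  using assms by (induction xs) fastforce+

lemma linear_subst:
  assumes "linear ts" "\<And>x. x \<in> vars_list ts \<Longrightarrow> distinct (occs (\<sigma> x))"
    "\<And>x y. x \<in> vars_list ts \<Longrightarrow> y \<in> vars_list ts \<Longrightarrow> x \<noteq> y \<Longrightarrow> set (occs (\<sigma> x)) \<inter> set (occs (\<sigma> y)) = {}"
  shows "linear (map (\<lambda>t. t \<cdot> \<sigma>) ts)"
  using assms unfolding linear_def occs_list_subst vars_list_def
  by (intro distinct_concat_map)

lemma flat_distinct: "flat t \<Longrightarrow> distinct (occs t)"
  by (auto simp: flat_def comp_def)

lemma linear_nth_disjoint:
  assumes "linear ts" "i < length ts" "j < length ts" "i \<noteq> j"
  shows "set (occs (ts ! i)) \<inter> set (occs (ts ! j)) = {}"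
  using assms
proof (induction ts arbitrary: i j)
  case (Cons t ts)
  have h: "set (occs t) \<inter> set (occs (ts ! k)) = {}" if "k < length ts" for k
    using Cons.prems(1) nth_mem[OF that] by (auto simp: linear_def occs_list_def)
  have l: "linear ts" using Cons.prems(1) by (simp add: linear_def)
  show ?case
    using Cons.prems h Cons.IH[OF l] by (cases i; cases j) auto
qed simp

text \<open>A variable pattern matches anything. A non-variable flat pattern shares its root symbol
  and argument count with \<open>s\<close> because the two are unifiable, and its arguments are
  distinct variables, so each can be sent to the corresponding argument of \<open>s\<close>.\<close>

lemma flat_match:
  assumes "p \<cdot> \<theta> = s \<cdot> \<theta>" "flat p" "is_variable p \<or> \<not> is_variable s"
  shows "\<exists>\<sigma>. p \<cdot> \<sigma> = s"
proof (cases "is_variable p")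
  case True
  then obtain x where "p = Var x" by (auto simp: is_variable_iff)
  then show ?thesis by (intro exI[of _ "\<lambda>_. s"]) simp
next
  case False
  then obtain f xs where p: "p = Fun f (map Var xs)" and d: "distinct xs"
    using assms(2) by (auto simp: flat_def)
  obtain ss where s: "s = Fun f ss" "length ss = length xs"
    using assms(1,3) False p by (cases s) (auto dest: map_eq_imp_length_eq)
  have "map (\<lambda>x. the (map_of (zip xs ss) x)) xs = ss"
    using d s(2) by (intro nth_equalityI) (auto simp: map_of_zip_nth)
  then show ?thesis
    using p s by (intro exI[of _ "\<lambda>x. the (map_of (zip xs ss) x)"]) (simp add: comp_def)
qed

text \<open>Linearity keeps the matchers of the single positions from interfering, so they can be
  glued together. That the result is the identity off the pattern is needed when several matchers
  are composed into one mgu.\<close>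

lemma linear_match:
  assumes "length ps = length ss" "linear ps"
    "\<And>p s. (p, s) \<in> set (zip ps ss) \<Longrightarrow> p \<cdot> \<theta> = s \<cdot> \<theta> \<and> flat p \<and> (is_variable p \<or> \<not> is_variable s)"
  shows "\<exists>\<sigma>. map (\<lambda>p. p \<cdot> \<sigma>) ps = ss \<and> (\<forall>x. x \<notin> vars_list ps \<longrightarrow> \<sigma> x = Var x)"
  using assms
proof (induction ps ss rule: list_induct2)
  case Nil
  show ?case by (intro exI[of _ Var]) simp
next
  case (Cons p ps s ss)
  obtain \<sigma> where \<sigma>: "map (\<lambda>p. p \<cdot> \<sigma>) ps = ss" "\<forall>x. x \<notin> vars_list ps \<longrightarrow> \<sigma> x = Var x"
    using Cons by (fastforce simp: linear_def)
  obtain \<rho> where \<rho>: "p \<cdot> \<rho> = s"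
    using flat_match[of p \<theta> s] Cons.prems(2)[of p s] by auto
  define \<sigma>' where "\<sigma>' x = (if x \<in> set (occs p) then \<rho> x else \<sigma> x)" for x
  have "p \<cdot> \<sigma>' = s"
    using \<rho> by (auto simp: \<sigma>'_def subst_trm_cong_iff)
  moreover have "map (\<lambda>p. p \<cdot> \<sigma>') ps = map (\<lambda>p. p \<cdot> \<sigma>) ps"
    using Cons.prems(1) unfolding map_subst_cong_iff
    by (auto simp: \<sigma>'_def linear_def vars_list_def)
  moreover have "\<forall>x. x \<notin> vars_list (p # ps) \<longrightarrow> \<sigma>' x = Var x"
    using \<sigma>(2) by (auto simp: \<sigma>'_def vars_list_def)
  ultimately show ?case using \<sigma>(1) by auto
qed

section \<open>Bijective extensions and fresh variables\<close>

text \<open>\<open>A\<close> and its image have equally many elements, hence so have their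
  complements in the finite union of the two; a bijection between these complements closes the map
  up. Variants are defined by bijections of all variables, while the proofs produce renamings that
  are injective only on finitely many.\<close>

lemma extend_to_bij:
  fixes f :: "'a \<Rightarrow> 'a"
  assumes "finite A" "inj_on f A"
  shows "\<exists>\<pi>. bij \<pi> \<and> (\<forall>x \<in> A. \<pi> x = f x)"
proof -
  let ?B = "A \<union> f ` A"
  have "card (?B - A) = card (?B - f ` A)"
    using assms by (simp add: card_Diff_subset card_image)
  then obtain g where g: "bij_betw g (?B - A) (?B - f ` A)"
    using assms(1) by (meson finite_Diff finite_UnI finite_imageI finite_same_card_bij)
  define \<pi> where "\<pi> x = (if x \<in> A then f x else if x \<in> ?B then g x else x)" for x
  have "bij_betw \<pi> A (f ` A)"
    using assms(2) by (auto simp: bij_betw_def \<pi>_def inj_on_def)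
  moreover have "bij_betw \<pi> (?B - A) (?B - f ` A)"
    using g by (rule bij_betw_cong[THEN iffD1, rotated]) (auto simp: \<pi>_def)
  moreover have "bij_betw \<pi> (- ?B) (- ?B)"
    by (auto simp: bij_betw_def \<pi>_def inj_on_def)
  ultimately have "bij_betw \<pi> ((A \<union> (?B - A)) \<union> - ?B) ((f ` A \<union> (?B - f ` A)) \<union> - ?B)"
    by (intro bij_betw_combine) auto
  moreover have "(A \<union> (?B - A)) \<union> - ?B = UNIV" "(f ` A \<union> (?B - f ` A)) \<union> - ?B = UNIV"
    by auto
  ultimately have "bij \<pi>" by simp
  then show ?thesis by (auto simp: \<pi>_def)
qed

lemma fresh_injection:
  fixes E :: "'a::infinite set"
  assumes "finite E" "finite D"
  shows "\<exists>f :: 'a \<Rightarrow> 'a. inj_on f E \<and> f ` E \<inter> D = {}"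
proof -
  have "infinite (UNIV - D)"
    using assms(2) infinite_UNIV by (simp add: Compl_eq_Diff_UNIV[symmetric])
  then obtain F where F: "finite F" "card F = card E" "F \<subseteq> UNIV - D"
    using infinite_arbitrarily_large by blast
  obtain f where "bij_betw f E F"
    using finite_same_card_bij[OF assms(1) F(1)] F(2) by auto
  then show ?thesis
    using F(3) by (intro exI[of _ f]) (auto simp: bij_betw_def)
qed

section \<open>Modes and types\<close>

abbreviation vars_atom :: "('f, 'v, 'p) atom \<Rightarrow> 'v set" where
  "vars_atom a \<equiv> vars_list (args a)"

abbreviation vars_in :: "('f, 'v, 'p) program \<Rightarrow> ('f, 'v, 'p) atom \<Rightarrow> 'v set" where
  "vars_in P a \<equiv> vars_list (in_args P a)"

abbreviation vars_out :: "('f, 'v, 'p) program \<Rightarrow> ('f, 'v, 'p) atom \<Rightarrow> 'v set" where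
  "vars_out P a \<equiv> vars_list (out_args P a)"

abbreviation outs :: "('f, 'v, 'p) program \<Rightarrow> ('f, 'v, 'p) query \<Rightarrow> ('f, 'v) trm list" where
  "outs P Q \<equiv> concat (map (out_args P) Q)"

lemma vars_list_append [simp]: "vars_list (ts @ us) = vars_list ts \<union> vars_list us"
  by (auto simp: vars_list_def)

lemma vars_list_outs: "vars_list (outs P Q) = (\<Union>a \<in> set Q. vars_out P a)"
  by (auto simp: vars_list_eq)

lemma subst_atom_simps [simp]:
  "pred (a \<cdot>a \<sigma>) = pred a" "args (a \<cdot>a \<sigma>) = map (\<lambda>t. t \<cdot> \<sigma>) (args a)"
  by (simp_all add: subst_atom_def)

lemma in_args_subst [simp]: "in_args P (a \<cdot>a \<sigma>) = map (\<lambda>t. t \<cdot> \<sigma>) (in_args P a)"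
  by (simp add: in_args_def nths_map)

lemma out_args_subst [simp]: "out_args P (a \<cdot>a \<sigma>) = map (\<lambda>t. t \<cdot> \<sigma>) (out_args P a)"
  by (simp add: out_args_def nths_map)

lemma wf_atom_subst [simp]: "wf_atom P (a \<cdot>a \<sigma>) = wf_atom P a"
  by (simp add: wf_atom_def)

lemma subst_atom_comp: "a \<cdot>a subst_comp \<sigma> \<tau> = a \<cdot>a \<sigma> \<cdot>a \<tau>"
  by (simp add: subst_atom_def subst_trm_comp)

lemma subst_query_comp: "Q \<cdot>q subst_comp \<sigma> \<tau> = Q \<cdot>q \<sigma> \<cdot>q \<tau>"
  by (simp add: subst_query_def subst_atom_comp)

lemma subst_atom_cong_iff: "a \<cdot>a \<sigma> = a \<cdot>a \<tau> \<longleftrightarrow> (\<forall>x \<in> vars_atom a. \<sigma> x = \<tau> x)"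
  by (simp add: subst_atom_def map_subst_cong_iff[symmetric])

lemma subst_query_cong_iff: "Q \<cdot>q \<sigma> = Q \<cdot>q \<tau> \<longleftrightarrow> (\<forall>x \<in> vars_query Q. \<sigma> x = \<tau> x)"
  by (simp add: subst_query_def vars_query_def subst_atom_cong_iff)

lemma subst_atom_Var: "a \<cdot>a Var = a"
  by (simp add: subst_atom_def subst_trm_Var)

lemma subst_query_Var: "Q \<cdot>q Var = Q"
  by (simp add: subst_query_def subst_atom_Var)

lemma subst_query_id: "\<forall>x \<in> vars_query Q. \<sigma> x = Var x \<Longrightarrow> Q \<cdot>q \<sigma> = Q"
  using subst_query_cong_iff[of Q \<sigma> Var] by (simp add: subst_query_Var)

lemma subst_query_simps [simp]:
  "[] \<cdot>q \<sigma> = []" "(a # Q) \<cdot>q \<sigma> = (a \<cdot>a \<sigma>) # (Q \<cdot>q \<sigma>)"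
  "(Q @ R) \<cdot>q \<sigma> = (Q \<cdot>q \<sigma>) @ (R \<cdot>q \<sigma>)" "set (Q \<cdot>q \<sigma>) = (\<lambda>a. a \<cdot>a \<sigma>) ` set Q"
  by (simp_all add: subst_query_def)

lemma vars_query_simps [simp]:
  "vars_query [] = {}" "vars_query (a # Q) = vars_atom a \<union> vars_query Q"
  "vars_query (Q @ R) = vars_query Q \<union> vars_query R"
  by (simp_all add: vars_query_def)

lemma finite_vars_query: "finite (vars_query Q)"
  by (simp add: vars_query_def finite_vars_list)

lemma vars_query_subst: "vars_query (Q \<cdot>q \<sigma>) = (\<Union>x \<in> vars_query Q. set (occs (\<sigma> x)))"
  by (auto simp: vars_query_def vars_list_subst)

lemma outs_subst: "outs P (Q \<cdot>q \<sigma>) = map (\<lambda>t. t \<cdot> \<sigma>) (outs P Q)"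
  by (induction Q) auto

lemma vars_in_subset: "vars_in P a \<subseteq> vars_atom a"
  by (auto simp: vars_list_eq in_args_def dest: in_set_nthsD)

lemma vars_out_subset: "vars_out P a \<subseteq> vars_atom a"
  by (auto simp: vars_list_eq out_args_def dest: in_set_nthsD)

lemma vars_atom_eq: "wf_atom P a \<Longrightarrow> vars_atom a = vars_in P a \<union> vars_out P a"
proof
  assume wf: "wf_atom P a"
  show "vars_atom a \<subseteq> vars_in P a \<union> vars_out P a"
  proof
    fix x assume "x \<in> vars_atom a"
    then obtain i where i: "i < length (args a)" "x \<in> set (occs (args a ! i))"
      unfolding vars_list_eq by (metis UN_E in_set_conv_nth)
    then have "i \<in> inpos P (pred a) \<or> i \<in> outpos P (pred a)"
      using wf by (cases "modes P (pred a) ! i") (auto simp: wf_atom_def inpos_def outpos_def)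
    then show "x \<in> vars_in P a \<union> vars_out P a"
      using i by (auto simp: vars_list_eq in_args_def out_args_def set_nths)
  qed
qed (use vars_in_subset[of P a] vars_out_subset[of P a] in blast)

lemma length_nths_eq: "length xs = length ys \<Longrightarrow> length (nths xs I) = length (nths ys I)"
  by (simp add: length_nths)

lemma zip_nths: "length xs = length ys \<Longrightarrow> zip (nths xs I) (nths ys I) = nths (zip xs ys) I"
proof (induction xs ys arbitrary: I rule: list_induct2)
  case (Cons x xs y ys)
  then show ?case by (simp add: nths_Cons)
qed simp

lemma set_zip_nths:
  "length xs = length ys \<Longrightarrow>
    set (zip (nths xs I) (nths ys I)) = {(xs ! i, ys ! i) |i. i < length ys \<and> i \<in> I}"
  by (auto simp: zip_nths set_nths) (metis nth_zip)

lemma set_zip_in_args: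
  "wf_atom P a \<Longrightarrow> wf_atom P b \<Longrightarrow> pred a = pred b \<Longrightarrow>
    set (zip (in_args P a) (in_args P b)) = {(args a ! i, args b ! i) |i. i \<in> inpos P (pred b)}"
  by (auto simp: in_args_def set_zip_nths wf_atom_def inpos_def)

lemma set_zip_out_args:
  "wf_atom P a \<Longrightarrow> wf_atom P b \<Longrightarrow> pred a = pred b \<Longrightarrow>
    set (zip (out_args P a) (out_args P b)) = {(args a ! i, args b ! i) |i. i \<in> outpos P (pred b)}"
  by (auto simp: out_args_def set_zip_nths wf_atom_def outpos_def)

lemma set_in_args: "wf_atom P a \<Longrightarrow> set (in_args P a) = {args a ! i |i. i \<in> inpos P (pred a)}"
  by (auto simp: in_args_def set_nths wf_atom_def inpos_def)

lemma set_out_args: "wf_atom P a \<Longrightarrow> set (out_args P a) = {args a ! i |i. i \<in> outpos P (pred a)}"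
  by (auto simp: out_args_def set_nths wf_atom_def outpos_def)

lemma inpos_less: "wf_atom P a \<Longrightarrow> i \<in> inpos P (pred a) \<Longrightarrow> i < length (args a)"
  by (simp add: wf_atom_def inpos_def)

lemma outpos_less: "wf_atom P a \<Longrightarrow> i \<in> outpos P (pred a) \<Longrightarrow> i < length (args a)"
  by (simp add: wf_atom_def outpos_def)

section \<open>Modes and types of queries split at an atom\<close>

text \<open>Replaces indices by splittings of the query, which combine well with concatenation:
  resolution replaces one atom in the middle by a whole list, and indices would have to be
  shifted.\<close>

lemma nicely_moded_query_iff:
  "nicely_moded_query P Q \<longleftrightarrow> linear (outs P Q) \<and>
    (\<forall>A b C. Q = A @ b # C \<longrightarrow> vars_in P b \<inter> vars_list (outs P (b # C)) = {})"
proof -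
  have "(\<forall>i < length Q. vars_in P (Q ! i) \<inter> (\<Union>j \<in> {i..<length Q}. vars_out P (Q ! j)) = {}) \<longleftrightarrow>
    (\<forall>A b C. Q = A @ b # C \<longrightarrow> vars_in P b \<inter> vars_list (outs P (b # C)) = {})" (is "?l \<longleftrightarrow> ?r")
  proof
    assume l: ?l
    show ?r
    proof (intro allI impI)
      fix A b C assume Q: "Q = A @ b # C"
      have "vars_list (outs P (b # C)) \<subseteq> (\<Union>j \<in> {length A..<length Q}. vars_out P (Q ! j))"
      proof
        fix x assume "x \<in> vars_list (outs P (b # C))"
        then obtain c where c: "c \<in> set (b # C)" "x \<in> vars_out P c"
          unfolding vars_list_outs by blast
        then obtain k where "k < length (b # C)" "c = (b # C) ! k"
          by (metis in_set_conv_nth)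
        then show "x \<in> (\<Union>j \<in> {length A..<length Q}. vars_out P (Q ! j))"
          using c Q by (intro UN_I[of "length A + k"]) auto
      qed
      then show "vars_in P b \<inter> vars_list (outs P (b # C)) = {}"
        using l[rule_format, of "length A"] Q by auto
    qed
  next
    assume r: ?r
    show ?l
    proof (intro allI impI)
      fix i assume i: "i < length Q"
      have "Q = take i Q @ Q ! i # drop (Suc i) Q"
        using i by (rule id_take_nth_drop)
      then have "vars_in P (Q ! i) \<inter> vars_list (outs P (Q ! i # drop (Suc i) Q)) = {}"
        using r by blast
      moreover have "(\<Union>j \<in> {i..<length Q}. vars_out P (Q ! j)) \<subseteq> vars_list (outs P (drop i Q))"
      proof clarify
        fix x j assume j: "j \<in> {i..<length Q}" "x \<in> vars_out P (Q ! j)"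
        then have "Q ! j \<in> set (drop i Q)"
          by (auto simp: in_set_conv_nth intro!: exI[of _ "j - i"])
        then show "x \<in> vars_list (outs P (drop i Q))"
          using j(2) unfolding vars_list_outs by blast
      qed
      ultimately show "vars_in P (Q ! i) \<inter> (\<Union>j \<in> {i..<length Q}. vars_out P (Q ! j)) = {}"
        using i by (auto simp: Cons_nth_drop_Suc[symmetric])
    qed
  qed
  then show ?thesis unfolding nicely_moded_query_def by blast
qed

lemma less_length_split:
  "(\<forall>i < length Q. R (take i Q) (Q ! i)) \<longleftrightarrow> (\<forall>A b C. Q = A @ b # C \<longrightarrow> R A b)"
proof
  assume l: "\<forall>i < length Q. R (take i Q) (Q ! i)"
  show "\<forall>A b C. Q = A @ b # C \<longrightarrow> R A b"
  proof (intro allI impI)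
    fix A b C assume "Q = A @ b # C"
    then show "R A b" using l[rule_format, of "length A"] by simp
  qed
next
  assume r: "\<forall>A b C. Q = A @ b # C \<longrightarrow> R A b"
  show "\<forall>i < length Q. R (take i Q) (Q ! i)"
    using r id_take_nth_drop by blast
qed

lemma append_eq_append_Cons:
  "X @ Y = A @ b # C \<Longrightarrow> (\<exists>D. X = A @ b # D) \<or> (\<exists>D. A = X @ D \<and> Y = D @ b # C)"
  by (fastforce simp: append_eq_append_conv2 append_eq_Cons_conv Cons_eq_append_conv)

lemma subst_query_eq_append_Cons:
  "Q \<cdot>q \<theta> = A @ b # C \<Longrightarrow>
    \<exists>A' b' C'. Q = A' @ b' # C' \<and> A = A' \<cdot>q \<theta> \<and> b = b' \<cdot>a \<theta> \<and> C = C' \<cdot>q \<theta>"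
  by (auto simp: subst_query_def map_eq_append_conv map_eq_Cons_conv)

lemma all_take:
  assumes "i < length Q"
  shows "(\<forall>c \<in> set (take i Q). R c) \<longleftrightarrow> (\<forall>j < i. R (Q ! j))"
proof -
  have "set (take i Q) = (\<lambda>j. Q ! j) ` {..<i}"
    using assms by (simp add: nth_image[symmetric] lessThan_atLeast0)
  then show ?thesis by auto
qed

lemma well_typed_query_iff:
  "well_typed_query P Q \<longleftrightarrow>
    (\<forall>A b C. Q = A @ b # C \<longrightarrow>
      (\<forall>\<sigma>. (\<forall>c \<in> set A. typed_out P (c \<cdot>a \<sigma>)) \<longrightarrow> typed_in P (b \<cdot>a \<sigma>)))"
  unfolding well_typed_query_def
    less_length_split[where R = "\<lambda>A b. \<forall>\<sigma>. (\<forall>c \<in> set A. typed_out P (c \<cdot>a \<sigma>)) \<longrightarrow> typed_in P (b \<cdot>a \<sigma>)", symmetric]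
  by (simp add: all_take)

lemma well_typed_clause_iff:
  "well_typed_clause P (Clause h B) \<longleftrightarrow>
    (\<forall>A b C. B = A @ b # C \<longrightarrow>
      (\<forall>\<sigma>. typed_in P (h \<cdot>a \<sigma>) \<and> (\<forall>c \<in> set A. typed_out P (c \<cdot>a \<sigma>)) \<longrightarrow> typed_in P (b \<cdot>a \<sigma>))) \<and>
    (\<forall>\<sigma>. typed_in P (h \<cdot>a \<sigma>) \<and> (\<forall>c \<in> set B. typed_out P (c \<cdot>a \<sigma>)) \<longrightarrow> typed_out P (h \<cdot>a \<sigma>))"
proof -
  have "(\<forall>\<sigma>. (\<forall>j < length B. typed_out P (B ! j \<cdot>a \<sigma>)) = (\<forall>c \<in> set B. typed_out P (c \<cdot>a \<sigma>)))"
    by (simp add: all_set_conv_all_nth)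
  then show ?thesis
    unfolding well_typed_clause_def less_length_split
      [where R = "\<lambda>A b. \<forall>\<sigma>. typed_in P (h \<cdot>a \<sigma>) \<and> (\<forall>c \<in> set A. typed_out P (c \<cdot>a \<sigma>)) \<longrightarrow> typed_in P (b \<cdot>a \<sigma>)", symmetric]
    by (simp add: all_take)
qed

text \<open>Typed information flows from left to right: typed outputs of \<open>Q1\<close> give
  typed inputs of \<open>a\<close>, hence of \<open>h\<close>; the clause then types the body inputs
  and, from the body outputs, the outputs of \<open>h\<close>; these are the outputs of
  \<open>a\<close>, on which \<open>Q2\<close> relies.\<close>

lemma well_typed_resolvent:
  assumes "well_typed_query P (Q1 @ a # Q2)" "well_typed_clause P (Clause h B)" "a \<cdot>a \<theta> = h \<cdot>a \<theta>"
  shows "well_typed_query P ((Q1 @ B @ Q2) \<cdot>q \<theta>)"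
proof -
  note wq = assms(1)[unfolded well_typed_query_iff, rule_format]
  note wc = assms(2)[unfolded well_typed_clause_iff]
  \<comment> \<open>Stated for an arbitrary unifier \<open>\<sigma>\<close> of \<open>a\<close> and
    \<open>h\<close>; it is later applied to \<open>\<theta>\<close> followed by the substitution
    under test.\<close>
  have *: "typed_in P (b \<cdot>a \<sigma>)"
    if Q: "Q1 @ B @ Q2 = A @ b # C" and A: "\<forall>c \<in> set A. typed_out P (c \<cdot>a \<sigma>)" and \<sigma>: "a \<cdot>a \<sigma> = h \<cdot>a \<sigma>"
    for A b C \<sigma>
  proof -
    have inh: "typed_in P (h \<cdot>a \<sigma>)" if "\<forall>c \<in> set Q1. typed_out P (c \<cdot>a \<sigma>)"
      using wq[of Q1 a Q2 \<sigma>] that \<sigma> by simp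
    consider (q1) D where "Q1 = A @ b # D" | (body) D E where "A = Q1 @ D" "B = D @ b # E"
      | (q2) D where "A = Q1 @ B @ D" "Q2 = D @ b # C"
      using append_eq_append_Cons[OF Q] append_eq_append_Cons[of B Q2 _ b C] by auto
    then show ?thesis
    proof cases
      case q1
      then show ?thesis using wq[of A b "D @ a # Q2"] A by simp
    next
      case body
      then show ?thesis using wc[THEN conjunct1, rule_format, of D b E \<sigma>] inh A by simp
    next
      case q2
      then have "typed_out P (a \<cdot>a \<sigma>)"
        using wc[THEN conjunct2, rule_format, of \<sigma>] inh A \<sigma> by simp
      then have "\<forall>c \<in> set (Q1 @ a # D). typed_out P (c \<cdot>a \<sigma>)" using A q2 by auto
      then show ?thesis by (intro wq[of "Q1 @ a # D" b C]) (auto simp: q2)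
    qed
  qed
  show ?thesis
    unfolding well_typed_query_iff
  proof (intro allI impI)
    fix A b C \<sigma>
    assume Q: "(Q1 @ B @ Q2) \<cdot>q \<theta> = A @ b # C" and A: "\<forall>c \<in> set A. typed_out P (c \<cdot>a \<sigma>)"
    obtain A' b' C' where "Q1 @ B @ Q2 = A' @ b' # C'" "A = A' \<cdot>q \<theta>" "b = b' \<cdot>a \<theta>"
      using subst_query_eq_append_Cons[OF Q] by blast
    then show "typed_in P (b \<cdot>a \<sigma>)"
      using *[of A' b' C' "subst_comp \<theta> \<sigma>"] A assms(3) by (auto simp: subst_atom_comp)
  qed
qed

section \<open>Unification of matching arguments\<close>

lemma zip_map_eq:
  "map f vs = map f ws \<Longrightarrow> (v, w) \<in> set (zip vs ws) \<Longrightarrow> f v = f w"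
  by (auto simp: in_set_zip) (metis length_map nth_map)

text \<open>In the application \<open>p\<close> and \<open>u\<close> are the inputs and outputs of
  the head, \<open>s\<close> and \<open>t\<close> those of the selected atom, and \<open>Y\<close>
  consists of the output variables of the body. Both \<open>p\<close> and \<open>t\<close> act as
  patterns. The mgu is built in three stages, each absorbed by every unifier; that absorption makes
  the composition most general and idempotent. The remaining conclusions record which variables are
  moved, and to where.\<close>

lemma producer_consumer_mgu:
  assumes len: "length p = length s" "length t = length u"
    and lin: "linear p" "linear t"
    and flat_p: "\<And>p' s'. (p', s') \<in> set (zip p s) \<Longrightarrow> flat p' \<and> (is_variable p' \<or> \<not> is_variable s')"
    and flat_t: "\<And>t'. t' \<in> set t \<Longrightarrow> flat t'"
    and disj: "vars_list p \<inter> vars_list s = {}" "vars_list t \<inter> (vars_list p \<union> vars_list s \<union> vars_list u) = {}"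
      "Y \<inter> (vars_list p \<union> vars_list s) = {}"
    and special: "\<And>t' x. (t', Var x) \<in> set (zip t u) \<Longrightarrow> \<not> is_variable t' \<Longrightarrow>
      x \<in> Y \<or> (\<exists>s'. (Var x, s') \<in> set (zip p s) \<and> \<not> is_variable s')"
    and unif: "map (\<lambda>t. t \<cdot> \<theta>) p = map (\<lambda>t. t \<cdot> \<theta>) s" "map (\<lambda>t. t \<cdot> \<theta>) t = map (\<lambda>t. t \<cdot> \<theta>) u"
  shows "\<exists>\<mu> X. map (\<lambda>t. t \<cdot> \<mu>) p = map (\<lambda>t. t \<cdot> \<mu>) s \<and> map (\<lambda>t. t \<cdot> \<mu>) t = map (\<lambda>t. t \<cdot> \<mu>) u \<and>
    (\<forall>\<tau>. map (\<lambda>t. t \<cdot> \<tau>) p = map (\<lambda>t. t \<cdot> \<tau>) s \<longrightarrow> map (\<lambda>t. t \<cdot> \<tau>) t = map (\<lambda>t. t \<cdot> \<tau>) u \<longrightarrow>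
      (\<forall>x. \<mu> x \<cdot> \<tau> = \<tau> x)) \<and>
    X \<subseteq> Y \<and>
    (\<forall>x \<in> X. (\<mu> x, Var x) \<in> set (zip t u) \<and> \<not> is_variable (\<mu> x)) \<and>
    (\<forall>x \<in> X. \<forall>y \<in> X. x \<noteq> y \<longrightarrow> set (occs (\<mu> x)) \<inter> set (occs (\<mu> y)) = {}) \<and>
    (\<forall>x. x \<notin> X \<union> vars_list p \<union> vars_list t \<longrightarrow> \<mu> x = Var x) \<and>
    (\<forall>x \<in> vars_list p. set (occs (\<mu> x)) \<subseteq> vars_list s) \<and>
    (\<forall>x \<in> vars_list t. set (occs (\<mu> x)) \<subseteq> vars_list s \<union> vars_list u \<union> vars_list t)"
proof -
  \<comment> \<open>First stage: the inputs of the head are matched onto those of the atom, which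
    stay as they are.\<close>
  obtain \<sigma>1 where \<sigma>1: "map (\<lambda>t. t \<cdot> \<sigma>1) p = s" "\<And>x. x \<notin> vars_list p \<Longrightarrow> \<sigma>1 x = Var x"
    using linear_match[OF len(1) lin(1), of \<theta>] flat_p zip_map_eq[OF unif(1)] by blast
  have \<sigma>1_unifier: "\<sigma>1 x \<cdot> \<tau> = \<tau> x" if "map (\<lambda>t. t \<cdot> \<tau>) p = map (\<lambda>t. t \<cdot> \<tau>) s" for \<tau> x
  proof (cases "x \<in> vars_list p")
    case True
    have "map (\<lambda>t. t \<cdot> subst_comp \<sigma>1 \<tau>) p = map (\<lambda>t. t \<cdot> \<tau>) p"
      using that \<sigma>1(1) by (simp add: subst_trm_comp comp_def flip: map_map[of "\<lambda>t. t \<cdot> \<tau>" "\<lambda>t. t \<cdot> \<sigma>1", unfolded comp_def])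
    then show ?thesis using True unfolding map_subst_cong_iff by (simp add: subst_comp_def)
  qed (simp add: \<sigma>1(2))
  have \<sigma>1_range: "set (occs (\<sigma>1 x)) \<subseteq> vars_list s" if "x \<in> vars_list p" for x
    using that \<sigma>1(1) vars_list_subst[of \<sigma>1 p] by auto
  \<comment> \<open>Second stage: the exceptional variables of \<open>u\<close>, which face a
    non-variable term of \<open>t\<close>. A variable may face several such terms; any one of them
    serves as its value \<open>g x\<close>, and the third stage settles the others.\<close>
  define X where "X = {x \<in> Y. \<exists>t'. (t', Var x) \<in> set (zip t u) \<and> \<not> is_variable t'}"
  have "\<forall>x \<in> X. \<exists>t'. (t', Var x) \<in> set (zip t u) \<and> \<not> is_variable t'"
    by (auto simp: X_def)
  then obtain g where g: "\<And>x. x \<in> X \<Longrightarrow> (g x, Var x) \<in> set (zip t u) \<and> \<not> is_variable (g x)"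
    by metis
  define \<sigma>2 where "\<sigma>2 x = (if x \<in> X then g x else Var x)" for x
  have \<sigma>2_unifier: "\<sigma>2 x \<cdot> \<tau> = \<tau> x" if "map (\<lambda>t. t \<cdot> \<tau>) t = map (\<lambda>t. t \<cdot> \<tau>) u" for \<tau> x
    using zip_map_eq[OF that, of "g x" "Var x"] g by (auto simp: \<sigma>2_def)
  \<comment> \<open>The value that \<open>u\<close> has after two stages. It is also the final
    common instance of \<open>t\<close> and \<open>u\<close>.\<close>
  define r where "r = map (\<lambda>t. t \<cdot> \<sigma>1 \<cdot> \<sigma>2) u"
  have len_r: "length t = length r" by (simp add: r_def len)
  have unif_r: "map (\<lambda>t. t \<cdot> \<tau>) r = map (\<lambda>t. t \<cdot> \<tau>) u"
    if "map (\<lambda>t. t \<cdot> \<tau>) p = map (\<lambda>t. t \<cdot> \<tau>) s" "map (\<lambda>t. t \<cdot> \<tau>) t = map (\<lambda>t. t \<cdot> \<tau>) u" for \<tau>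
  proof -
    have "v \<cdot> \<sigma>1 \<cdot> \<sigma>2 \<cdot> \<tau> = v \<cdot> \<tau>" for v
      using \<sigma>1_unifier[OF that(1)] \<sigma>2_unifier[OF that(2)] by (simp add: subst_trm_absorb)
    then show ?thesis by (simp add: r_def)
  qed
  \<comment> \<open>By \<open>special\<close>, a variable of \<open>u\<close> that faces a
    non-variable term has been replaced by a non-variable term in one of the two stages. So
    \<open>t\<close> can now be matched onto \<open>r\<close>, which is the third stage.\<close>
  have flat_r: "is_variable t' \<or> \<not> is_variable r'" if tr: "(t', r') \<in> set (zip t r)" for t' r'
  proof (rule ccontr)
    assume neg: "\<not> (is_variable t' \<or> \<not> is_variable r')"
    obtain u' where u': "(t', u') \<in> set (zip t u)" "r' = u' \<cdot> \<sigma>1 \<cdot> \<sigma>2"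
      using tr by (auto simp: r_def zip_map2)
    then have "is_variable u'" "is_variable (u' \<cdot> \<sigma>1)"
      using neg not_is_variable_subst by blast+
    then obtain x where x: "u' = Var x" by (auto simp: is_variable_iff)
    have "x \<notin> vars_list p" if "x \<in> Y" using that disj(3) by auto
    moreover have "\<not> is_variable (\<sigma>1 x)" if "(Var x, s') \<in> set (zip p s)" "\<not> is_variable s'" for s'
      using that \<sigma>1(1) by (auto simp: in_set_zip)
    ultimately have "x \<in> Y" "\<sigma>1 x = Var x"
      using special[of t' x] u'(1) x neg \<open>is_variable (u' \<cdot> \<sigma>1)\<close> \<sigma>1(2) by auto
    then have "x \<in> X" using u'(1) x neg by (auto simp: X_def)
    then have "\<not> is_variable r'" using u'(2) x \<open>\<sigma>1 x = Var x\<close> g by (simp add: \<sigma>2_def)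
    then show False using neg by simp
  qed
  have "map (\<lambda>t. t \<cdot> \<theta>) t = map (\<lambda>t. t \<cdot> \<theta>) r"
    using unif_r[OF unif] unif(2) by simp
  then obtain \<sigma>3 where \<sigma>3: "map (\<lambda>t. t \<cdot> \<sigma>3) t = r" "\<And>x. x \<notin> vars_list t \<Longrightarrow> \<sigma>3 x = Var x"
    using linear_match[OF len_r lin(2), of \<theta>] flat_t flat_r zip_map_eq by (metis set_zip_leftD)
  have \<sigma>3_unifier: "\<sigma>3 x \<cdot> \<tau> = \<tau> x"
    if "map (\<lambda>t. t \<cdot> \<tau>) p = map (\<lambda>t. t \<cdot> \<tau>) s" "map (\<lambda>t. t \<cdot> \<tau>) t = map (\<lambda>t. t \<cdot> \<tau>) u" for \<tau> x
  proof (cases "x \<in> vars_list t")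
    case True
    have "map (\<lambda>t. t \<cdot> subst_comp \<sigma>3 \<tau>) t = map (\<lambda>t. t \<cdot> \<tau>) r"
      by (simp add: subst_trm_comp comp_def \<sigma>3(1)[symmetric])
    then have "map (\<lambda>t. t \<cdot> subst_comp \<sigma>3 \<tau>) t = map (\<lambda>t. t \<cdot> \<tau>) t"
      using unif_r[OF that] that(2) by simp
    then show ?thesis using True unfolding map_subst_cong_iff by (simp add: subst_comp_def)
  qed (simp add: \<sigma>3(2))
  define \<mu> where "\<mu> x = \<sigma>1 x \<cdot> \<sigma>2 \<cdot> \<sigma>3" for x
  have \<mu>: "v \<cdot> \<mu> = v \<cdot> \<sigma>1 \<cdot> \<sigma>2 \<cdot> \<sigma>3" for v
    using subst_trm_cong_iff[of v \<mu> "subst_comp (subst_comp \<sigma>1 \<sigma>2) \<sigma>3"]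
    by (simp add: \<mu>_def subst_comp_def[symmetric] subst_trm_comp) (simp add: subst_comp_def subst_trm_comp)
  have XY: "X \<subseteq> Y" by (auto simp: X_def)
  have g_t: "set (occs (g x)) \<subseteq> vars_list t" if "x \<in> X" for x
    using g[OF that] by (auto simp: vars_list_eq dest: set_zip_leftD)
  have X_u: "x \<in> vars_list u" if "x \<in> X" for x
    using g[OF that] by (force simp: vars_list_eq dest: set_zip_rightD)
  \<comment> \<open>The position of \<open>t\<close> that supplied \<open>g x\<close> is matched
    against \<open>g x\<close> itself, because \<open>u\<close> has \<open>x\<close> there. Hence
    the third stage does not alter what the second has inserted.\<close>
  have \<sigma>3_g: "g x \<cdot> \<sigma>3 = g x" if "x \<in> X" for x
  proof -
    have "\<sigma>1 x = Var x" using that XY disj(3) \<sigma>1(2) by auto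
    moreover have "(g x, Var x) \<in> set (zip t u)" using g[OF that] by simp
    then obtain i where i: "i < length t" "t ! i = g x" "u ! i = Var x"
      by (auto simp: in_set_zip)
    ultimately have "r ! i = g x" using that len(2) by (simp add: r_def \<sigma>2_def)
    then show ?thesis using i \<sigma>3(1) by (metis nth_map)
  qed
  have \<mu>_X: "\<mu> x = g x" if "x \<in> X" for x
  proof -
    have "\<sigma>1 x = Var x" using that XY disj(3) \<sigma>1(2) by auto
    then show ?thesis using \<sigma>3_g that by (simp add: \<mu>_def \<sigma>2_def)
  qed
  have \<mu>_t: "\<mu> x = \<sigma>3 x" if "x \<in> vars_list t" for x
  proof -
    have "x \<notin> X" using that X_u disj(2) by auto
    moreover have "\<sigma>1 x = Var x" using that disj(2) by (intro \<sigma>1(2)) auto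
    ultimately show ?thesis by (simp add: \<mu>_def \<sigma>2_def)
  qed
  have \<mu>_other: "\<mu> x = Var x" if "x \<notin> X \<union> vars_list p \<union> vars_list t" for x
    using that \<sigma>1(2) \<sigma>3(2) by (simp add: \<mu>_def \<sigma>2_def)
  have \<mu>_s: "\<mu> x = Var x" if "x \<in> vars_list s" for x
    using that disj XY by (intro \<mu>_other) auto
  have \<mu>_p: "\<mu> x = \<sigma>1 x" if "x \<in> vars_list p" for x
  proof -
    have "v \<cdot> \<sigma>2 \<cdot> \<sigma>3 = v" if "set (occs v) \<subseteq> vars_list s" for v
    proof -
      have "v \<cdot> \<sigma>2 = v" using that disj(3) XY by (intro subst_trm_id) (auto simp: \<sigma>2_def)
      moreover have "v \<cdot> \<sigma>3 = v" using that disj(2) by (intro subst_trm_id ballI \<sigma>3(2)) auto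
      ultimately show ?thesis by simp
    qed
    then show ?thesis using \<sigma>1_range[OF that] by (simp add: \<mu>_def)
  qed
  have range_r: "vars_list r \<subseteq> vars_list s \<union> vars_list u \<union> vars_list t"
  proof -
    have "set (occs (\<sigma>1 x)) \<subseteq> vars_list s \<union> {x}" for x
      using \<sigma>1_range \<sigma>1(2) by (cases "x \<in> vars_list p") auto
    moreover have "set (occs (\<sigma>2 x)) \<subseteq> vars_list t \<union> {x}" for x
      using g_t by (auto simp: \<sigma>2_def)
    moreover have "vars_list r = (\<Union>x \<in> vars_list u. \<Union>y \<in> set (occs (\<sigma>1 x)). set (occs (\<sigma>2 y)))"
      by (auto simp: r_def vars_list_eq occs_subst)
    ultimately show ?thesis by fastforce
  qed
  have "map (\<lambda>t. t \<cdot> \<mu>) p = s"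
    using \<sigma>1(1) \<mu>_p by (metis map_subst_cong_iff)
  moreover have "map (\<lambda>t. t \<cdot> \<mu>) s = s"
    using \<mu>_s by (intro map_idI subst_trm_id) (auto simp: vars_list_eq)
  moreover have "map (\<lambda>t. t \<cdot> \<mu>) t = r"
    using \<sigma>3(1) \<mu>_t by (metis map_subst_cong_iff)
  moreover have "map (\<lambda>t. t \<cdot> \<mu>) u = r"
  proof -
    have "w \<cdot> \<sigma>1 \<cdot> \<sigma>2 \<cdot> \<sigma>3 = w \<cdot> \<sigma>1 \<cdot> \<sigma>2" if "w \<in> set u" for w
    proof (intro subst_trm_id ballI)
      fix y assume "y \<in> set (occs (w \<cdot> \<sigma>1 \<cdot> \<sigma>2))"
      then obtain x where x: "x \<in> set (occs (w \<cdot> \<sigma>1))" "y \<in> set (occs (\<sigma>2 x))"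
        by (auto simp: occs_subst)
      show "\<sigma>3 y = Var y"
      proof (cases "x \<in> X")
        case True
        then have "g x \<cdot> \<sigma>3 = g x \<cdot> Var" using \<sigma>3_g by (simp add: subst_trm_Var)
        then show ?thesis using x(2) True unfolding subst_trm_cong_iff by (simp add: \<sigma>2_def)
      next
        case False
        then have "y = x" using x(2) by (simp add: \<sigma>2_def)
        moreover obtain z where "z \<in> set (occs w)" "x \<in> set (occs (\<sigma>1 z))"
          using x(1) by (auto simp: occs_subst)
        moreover from this have "z \<in> vars_list u" using that by (auto simp: vars_list_eq)
        ultimately have "y \<in> vars_list s \<or> y \<in> vars_list u"
          using \<sigma>1_range[of z] \<sigma>1(2)[of z] by (cases "z \<in> vars_list p") auto
        then show ?thesis using disj(2) by (intro \<sigma>3(2)) auto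
      qed
    qed
    then show ?thesis by (simp add: r_def \<mu>)
  qed
  moreover have "\<mu> x \<cdot> \<tau> = \<tau> x"
    if "map (\<lambda>t. t \<cdot> \<tau>) p = map (\<lambda>t. t \<cdot> \<tau>) s" "map (\<lambda>t. t \<cdot> \<tau>) t = map (\<lambda>t. t \<cdot> \<tau>) u" for \<tau> x
  proof -
    have "v \<cdot> \<sigma>3 \<cdot> \<tau> = v \<cdot> \<tau>" for v
      using \<sigma>3_unifier[OF that] by (rule subst_trm_absorb)
    moreover have "v \<cdot> \<sigma>2 \<cdot> \<tau> = v \<cdot> \<tau>" for v
      using \<sigma>2_unifier[OF that(2)] by (rule subst_trm_absorb)
    ultimately show ?thesis using \<sigma>1_unifier[OF that(1)] by (simp add: \<mu>_def)
  qed
  moreover have "set (occs (\<mu> x)) \<inter> set (occs (\<mu> y)) = {}" if "x \<in> X" "y \<in> X" "x \<noteq> y" for x y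
  proof -
    have "(g x, Var x) \<in> set (zip t u)" "(g y, Var y) \<in> set (zip t u)"
      using g that by simp_all
    then obtain i j where ij: "i < length t" "t ! i = g x" "u ! i = Var x"
      "j < length t" "t ! j = g y" "u ! j = Var y"
      by (auto simp: in_set_zip)
    then have "i \<noteq> j" using \<open>x \<noteq> y\<close> by auto
    with ij show ?thesis using linear_nth_disjoint[OF lin(2), of i j] that \<mu>_X by auto
  qed
  moreover have "set (occs (\<mu> x)) \<subseteq> vars_list s \<union> vars_list u \<union> vars_list t" if "x \<in> vars_list t" for x
  proof -
    have "set (occs (\<sigma>3 x)) \<subseteq> vars_list r"
      using that \<sigma>3(1) vars_list_subst[of \<sigma>3 t] by auto
    then show ?thesis using \<mu>_t[OF that] range_r by auto
  qed
  ultimately show ?thesis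
    using XY \<mu>_X g \<mu>_other \<mu>_p \<sigma>1_range by (intro exI[of _ \<mu>] exI[of _ X]) (simp)
qed

section \<open>Unique output positions and invariance under renaming\<close>

text \<open>Robust typing says nothing about the number of arguments, so the arity condition is
  carried along; it ensures that the input and output positions cover all arguments.\<close>

definition good_query :: "('f, 'v, 'p) program \<Rightarrow> ('f, 'v, 'p) query \<Rightarrow> bool" where
  "good_query P Q \<longleftrightarrow> robustly_typed_query P Q \<and> (\<forall>a \<in> set Q. wf_atom P a)"

lemma linear_append:
  "linear (ts @ us) \<longleftrightarrow> linear ts \<and> linear us \<and> vars_list ts \<inter> vars_list us = {}"
  by (auto simp: linear_def vars_list_def)

lemma linear_nths_unique:
  assumes "linear (nths ts I)" "i \<in> I" "k \<in> I" "i < length ts" "k < length ts"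
    "x \<in> set (occs (ts ! i))" "x \<in> set (occs (ts ! k))"
  shows "i = k"
  using assms
proof (induction ts arbitrary: I i k)
  case (Cons t ts)
  let ?J = "{j. Suc j \<in> I}"
  have later: "x \<in> vars_list (nths ts ?J)" if "Suc j \<in> I" "j < length ts" "x \<in> set (occs (ts ! j))" for j
    using that by (auto simp: vars_list_eq set_nths)
  have lin: "linear (nths ts ?J)"
    using Cons.prems(1) by (auto simp: nths_Cons linear_def)
  have disj: "set (occs t) \<inter> vars_list (nths ts ?J) = {}" if "0 \<in> I"
    using Cons.prems(1) that by (auto simp: nths_Cons linear_def vars_list_def)
  show ?case
  proof (cases i; cases k)
    fix i' k' assume "i = Suc i'" "k = Suc k'"
    then show "i = k" using Cons.IH[OF lin, of i' k'] Cons.prems by simp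
  next
    fix k' assume "i = 0" "k = Suc k'"
    then show "i = k" using disj later[of k'] Cons.prems by auto
  next
    fix i' assume "i = Suc i'" "k = 0"
    then show "i = k" using disj later[of i'] Cons.prems by auto
  qed simp
qed simp

text \<open>Identifies the body position in which an exceptional variable of the head output occurs,
  so that the type promised by robust typing of the clause is the type of that very
  position.\<close>

lemma linear_outs_unique:
  assumes "linear (outs P B)" "\<forall>b \<in> set B. wf_atom P b" "b \<in> set B" "c \<in> set B"
    "i \<in> outpos P (pred b)" "k \<in> outpos P (pred c)"
    "x \<in> set (occs (args b ! i))" "x \<in> set (occs (args c ! k))"
  shows "b = c \<and> i = k"
  using assms
proof (induction B)
  case (Cons d B)
  have out: "x \<in> vars_out P e"
    if "wf_atom P e" "j \<in> outpos P (pred e)" "x \<in> set (occs (args e ! j))" for e j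
    using that by (auto simp: vars_list_eq set_out_args)
  have lin: "linear (out_args P d)" "linear (outs P B)" "vars_out P d \<inter> vars_list (outs P B) = {}"
    using Cons.prems(1) by (simp_all add: linear_append)
  have x: "x \<in> vars_out P b" "x \<in> vars_out P c"
    using Cons.prems out by auto
  consider "b = d" "c = d" | "b \<in> set B" "c \<in> set B" | "b = d" "c \<in> set B" | "c = d" "b \<in> set B"
    using Cons.prems(3,4) by auto
  then show ?case
  proof cases
    case 1
    then show ?thesis
      using linear_nths_unique[OF lin(1)[unfolded out_args_def], of i k x] Cons.prems
      by (auto simp: outpos_less)
  next
    case 2
    then show ?thesis using Cons by (auto simp: linear_append)
  next
    case 3
    then show ?thesis using x lin(3) unfolding vars_list_outs by blast
  next
    case 4
    then show ?thesis using x lin(3) unfolding vars_list_outs by blast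
  qed
qed simp

text \<open>The two equations are oriented by data flow: in the first the head supplies the
  patterns, in the second the atom does.\<close>

lemma unifier_iff:
  assumes "wf_atom P a" "wf_atom P h" "pred a = pred h"
  shows "a \<cdot>a \<sigma> = h \<cdot>a \<sigma> \<longleftrightarrow>
    map (\<lambda>t. t \<cdot> \<sigma>) (in_args P h) = map (\<lambda>t. t \<cdot> \<sigma>) (in_args P a) \<and>
    map (\<lambda>t. t \<cdot> \<sigma>) (out_args P a) = map (\<lambda>t. t \<cdot> \<sigma>) (out_args P h)" (is "?l \<longleftrightarrow> ?i \<and> ?o")
proof
  assume l: ?l
  have "in_args P (a \<cdot>a \<sigma>) = in_args P (h \<cdot>a \<sigma>)" "out_args P (a \<cdot>a \<sigma>) = out_args P (h \<cdot>a \<sigma>)"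
    using l by simp_all
  then show "?i \<and> ?o" by simp
next
  assume r: "?i \<and> ?o"
  have len: "length (args a) = length (args h)" using assms by (simp add: wf_atom_def)
  have "args a ! i \<cdot> \<sigma> = args h ! i \<cdot> \<sigma>" if i: "i < length (args h)" for i
  proof -
    consider "i \<in> inpos P (pred a)" | "i \<in> outpos P (pred h)"
      using i assms by (cases "modes P (pred a) ! i") (auto simp: wf_atom_def inpos_def outpos_def)
    then show ?thesis
    proof cases
      case 1
      then have "(args h ! i, args a ! i) \<in> set (zip (in_args P h) (in_args P a))"
        using assms by (auto simp: set_zip_in_args)
      then show ?thesis using zip_map_eq[OF conjunct1[OF r]] by auto
    next
      case 2
      then have "(args a ! i, args h ! i) \<in> set (zip (out_args P a) (out_args P h))"
        using assms by (auto simp: set_zip_out_args)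
      then show ?thesis using zip_map_eq[OF conjunct2[OF r]] by auto
    qed
  qed
  then show ?l
    using len assms(3) by (auto simp: subst_atom_def intro: nth_equalityI)
qed

lemma vars_list_rename: "vars_list (map (\<lambda>t. t \<cdot> (\<lambda>x. Var (\<rho> x))) ts) = \<rho> ` vars_list ts"
  by (auto simp: vars_list_subst)

lemma robust_pos_rename:
  assumes "robust_pos P a i" "i < length (args a)" "inj \<rho>"
  shows "robust_pos P (a \<cdot>a (\<lambda>x. Var (\<rho> x))) i"
proof -
  let ?v = "\<lambda>x. Var (\<rho> x)"
  have "flat (t \<cdot> ?v)" if "flat t" for t :: "('a, 'b) trm"
    using that unfolding flat_def
  proof (elim disjE exE conjE)
    fix f xs assume "distinct xs" "t = Fun f (map Var xs)"
    then have "distinct (map \<rho> xs)" "t \<cdot> ?v = Fun f (map Var (map \<rho> xs))"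
      using assms(3) by (auto simp: distinct_map intro: inj_on_subset)
    then show "(\<exists>x. t \<cdot> ?v = Var x) \<or> (\<exists>f xs. distinct xs \<and> t \<cdot> ?v = Fun f (map Var xs))"
      by blast
  qed auto
  moreover have "type_consistent (t \<cdot> ?v) T" if "type_consistent t T" for t :: "('a, 'b) trm" and T
  proof -
    from that obtain \<sigma> where "t \<cdot> \<sigma> \<in> T" by (auto simp: type_consistent_def)
    moreover have "t \<cdot> ?v \<cdot> (\<lambda>y. \<sigma> (inv \<rho> y)) = t \<cdot> \<sigma>"
      using assms(3) by (simp add: subst_trm_comp[symmetric] subst_trm_cong_iff subst_comp_def)
    ultimately show ?thesis unfolding type_consistent_def by metis
  qed
  ultimately show ?thesis
    using assms(1,2) by (auto simp: robust_pos_def is_variable_iff)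
qed

lemma nicely_moded_query_rename:
  assumes "nicely_moded_query P Q" "inj \<rho>"
  shows "nicely_moded_query P (Q \<cdot>q (\<lambda>x. Var (\<rho> x)))"
  unfolding nicely_moded_query_iff outs_subst
proof (intro conjI allI impI)
  show "linear (map (\<lambda>t. t \<cdot> (\<lambda>x. Var (\<rho> x))) (outs P Q))"
    using assms by (intro linear_subst) (auto simp: nicely_moded_query_iff inj_eq)
next
  fix A b C assume "Q \<cdot>q (\<lambda>x. Var (\<rho> x)) = A @ b # C"
  then obtain A' b' C' where Q: "Q = A' @ b' # C'"
    and bC: "b = b' \<cdot>a (\<lambda>x. Var (\<rho> x))" "C = C' \<cdot>q (\<lambda>x. Var (\<rho> x))"
    using subst_query_eq_append_Cons by blast
  have "vars_in P b' \<inter> vars_list (outs P (b' # C')) = {}"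
    using assms(1) Q unfolding nicely_moded_query_iff by blast
  then have "\<rho> ` vars_in P b' \<inter> \<rho> ` vars_list (outs P (b' # C')) = {}"
    using assms(2) by (simp flip: image_Int)
  moreover have "b # C = (b' # C') \<cdot>q (\<lambda>x. Var (\<rho> x))" using bC by simp
  ultimately show "vars_in P b \<inter> vars_list (outs P (b # C)) = {}"
    using bC(1) by (simp only: outs_subst vars_list_rename in_args_subst)
qed

lemma robustly_typed_clause_rename:
  assumes rt: "robustly_typed_clause P C" and wf: "\<forall>a \<in> clause_atoms C. wf_atom P a" and inj: "inj \<rho>"
  defines "v \<equiv> \<lambda>x. Var (\<rho> x)"
  shows "robustly_typed_clause P (Clause (head C \<cdot>a v) (body C \<cdot>q v))"
proof -
  have wf_h: "wf_atom P (head C)" and wf_B: "\<And>b. b \<in> set (body C) \<Longrightarrow> wf_atom P b"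
    using wf by (auto simp: clause_atoms_def)
  have nm: "nicely_moded_query P (body C)"
    "vars_in P (head C) \<inter> (\<Union>a \<in> set (body C). vars_out P a) = {}"
    using rt by (auto simp: robustly_typed_clause_def nicely_moded_clause_def)
  have "nicely_moded_clause P (Clause (head C \<cdot>a v) (body C \<cdot>q v))"
  proof -
    have "\<rho> ` vars_in P (head C) \<inter> \<rho> ` (\<Union>a \<in> set (body C). vars_out P a) = {}"
      using nm(2) inj by (simp flip: image_Int)
    then show ?thesis
      using nicely_moded_query_rename[OF nm(1) inj]
      by (simp add: nicely_moded_clause_def v_def vars_list_rename image_UN)
  qed
  moreover have "well_typed_clause P (Clause (head C \<cdot>a v) (body C \<cdot>q v))"
    unfolding well_typed_clause_iff
  proof (intro conjI allI impI)
    have wt: "well_typed_clause P (Clause (head C) (body C))"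
      using rt by (simp add: robustly_typed_clause_def)
    note wt = wt[unfolded well_typed_clause_iff]
    fix \<sigma>
    show "typed_out P (head C \<cdot>a v \<cdot>a \<sigma>)"
      if "typed_in P (head C \<cdot>a v \<cdot>a \<sigma>) \<and> (\<forall>c \<in> set (body C \<cdot>q v). typed_out P (c \<cdot>a \<sigma>))"
      using that wt[THEN conjunct2, rule_format, of "subst_comp v \<sigma>"] by (simp add: subst_atom_comp)
    fix A b D
    assume B: "body C \<cdot>q v = A @ b # D"
      and t: "typed_in P (head C \<cdot>a v \<cdot>a \<sigma>) \<and> (\<forall>c \<in> set A. typed_out P (c \<cdot>a \<sigma>))"
    obtain A' b' D' where "body C = A' @ b' # D'" "A = A' \<cdot>q v" "b = b' \<cdot>a v"
      using subst_query_eq_append_Cons[OF B] by blast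
    then show "typed_in P (b \<cdot>a \<sigma>)"
      using t wt[THEN conjunct1, rule_format, of A' b' D' "subst_comp v \<sigma>"]
      by (simp add: subst_atom_comp)
  qed
  moreover have "robust_pos P (head C \<cdot>a v) i" if "i \<in> inpos P (pred (head C))" for i
    unfolding v_def using that rt wf_h inj
    by (intro robust_pos_rename) (auto simp: robustly_typed_clause_def inpos_less)
  moreover have "robust_pos P (b \<cdot>a v) i" if "b \<in> set (body C)" "i \<in> outpos P (pred b)" for b i
    unfolding v_def using that rt wf_B inj
    by (intro robust_pos_rename outpos_less) (auto simp: robustly_typed_clause_def)
  moreover have "(\<exists>k \<in> inpos P (pred (head C)). bound_pos P (pred (head C)) k \<and>
        args (head C \<cdot>a v) ! k = Var x \<and> types P (pred (head C)) ! k = types P (pred (head C)) ! i) \<or>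
      (\<exists>a \<in> set (body C \<cdot>q v). \<exists>k \<in> outpos P (pred a). bound_pos P (pred a) k \<and>
        args a ! k = Var x \<and> types P (pred a) ! k = types P (pred (head C)) ! i)"
    if i: "i \<in> outpos P (pred (head C))" "bound_pos P (pred (head C)) i" "args (head C \<cdot>a v) ! i = Var x"
    for i x
  proof -
    obtain y where y: "args (head C) ! i = Var y" "x = \<rho> y"
      using i outpos_less[OF wf_h] by (cases "args (head C) ! i") (auto simp: v_def)
    have "(\<exists>k \<in> inpos P (pred (head C)). bound_pos P (pred (head C)) k \<and>
        args (head C) ! k = Var y \<and> types P (pred (head C)) ! k = types P (pred (head C)) ! i) \<or>
      (\<exists>a \<in> set (body C). \<exists>k \<in> outpos P (pred a). bound_pos P (pred a) k \<and>
        args a ! k = Var y \<and> types P (pred a) ! k = types P (pred (head C)) ! i)"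
      using rt i y(1) unfolding robustly_typed_clause_def by blast
    then show ?thesis
    proof (elim disjE bexE conjE)
      fix k assume "k \<in> inpos P (pred (head C))" "bound_pos P (pred (head C)) k"
        "args (head C) ! k = Var y" "types P (pred (head C)) ! k = types P (pred (head C)) ! i"
      then show ?thesis
        using y(2) inpos_less[OF wf_h] by (intro disjI1 bexI[of _ k]) (auto simp: v_def)
    next
      fix a k assume "a \<in> set (body C)" "k \<in> outpos P (pred a)" "bound_pos P (pred a) k"
        "args a ! k = Var y" "types P (pred a) ! k = types P (pred (head C)) ! i"
      then show ?thesis
        using y(2) outpos_less[OF wf_B]
        by (intro disjI2 bexI[of _ "a \<cdot>a v"] bexI[of _ k]) (auto simp: v_def)
    qed
  qed
  ultimately show ?thesis
    unfolding robustly_typed_clause_def by (simp del: subst_atom_simps(2))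
qed

lemma clause_variant:
  assumes "wf_program P" "robustly_typed_program P" "input_linear_program P"
    and C: "C \<in> clauses P" "variant_of (Clause h B) C"
  shows "robustly_typed_clause P (Clause h B)" "linear (in_args P h)" "wf_atom P h"
    "\<forall>b \<in> set B. wf_atom P b" "pred h \<in> preds P" "\<forall>b \<in> set B. pred b \<in> preds P"
    "pred h = pred (head C)" "pred ` set B = pred ` set (body C)"
proof -
  obtain \<rho> where \<rho>: "bij \<rho>" "h = head C \<cdot>a (\<lambda>x. Var (\<rho> x))" "B = body C \<cdot>q (\<lambda>x. Var (\<rho> x))"
    using C(2) by (auto simp: variant_of_def)
  have inj: "inj \<rho>" using \<rho>(1) by (rule bij_is_inj)
  have wf: "\<forall>a \<in> clause_atoms C. wf_atom P a" using assms(1) C(1) by (simp add: wf_program_def)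
  show "robustly_typed_clause P (Clause h B)"
    using robustly_typed_clause_rename[OF _ wf inj] assms(2) C(1) \<rho>(2,3)
    by (simp add: robustly_typed_program_def)
  have "linear (in_args P (head C))"
    using assms(3) C(1) by (auto simp: input_linear_program_def)
  then show "linear (in_args P h)"
    using inj unfolding \<rho>(2) in_args_subst by (intro linear_subst) (auto simp: inj_eq)
  show "wf_atom P h" "\<forall>b \<in> set B. wf_atom P b"
    using wf \<rho> by (auto simp: clause_atoms_def)
  show "pred h \<in> preds P" "\<forall>b \<in> set B. pred b \<in> preds P"
    using \<rho> C(1) by (auto simp: clause_atoms_def preds_def)
  show "pred h = pred (head C)" "pred ` set B = pred ` set (body C)"
    using \<rho>(2,3) by (auto simp: image_image)
qed

section \<open>Resolvents\<close>

lemma robust_pos_flat: "robust_pos P a i \<Longrightarrow> flat (args a ! i)"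
  by (auto simp: robust_pos_def is_variable_iff flat_def split: if_splits)

text \<open>The mgu obtained from the oriented equations moves only outputs of the atom and
  variables of the clause. Output variables of the resolvent are either fixed or receive distinct,
  variable-disjoint outputs of the selected atom, so linearity, the mode condition and robust
  positions survive; well-typedness holds for any unifier.\<close>

lemma canonical_resolvent:
  assumes P: "wf_program P" "robustly_typed_program P" "input_linear_program P" "input_selectability P"
    and Q: "good_query P (Q1 @ a # Q2)" and sel: "selectable P a"
    and C: "C \<in> clauses P" "variant_of (Clause h B) C"
    and apart: "vars_query (h # B) \<inter> vars_query (Q1 @ a # Q2) = {}"
    and unif: "a \<cdot>a \<theta> = h \<cdot>a \<theta>"
  shows "\<exists>\<mu>. a \<cdot>a \<mu> = h \<cdot>a \<mu> \<and> (\<forall>\<tau>. a \<cdot>a \<tau> = h \<cdot>a \<tau> \<longrightarrow> (\<forall>x. \<mu> x \<cdot> \<tau> = \<tau> x)) \<and>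
    (\<forall>x. x \<notin> vars_out P a \<union> vars_query (h # B) \<longrightarrow> \<mu> x = Var x) \<and>
    (\<forall>x \<in> vars_out P a \<union> vars_query (h # B). set (occs (\<mu> x)) \<subseteq> vars_atom a \<union> vars_query (h # B)) \<and>
    good_query P ((Q1 @ B @ Q2) \<cdot>q \<mu>)"
proof -
  note cl = clause_variant[OF P(1-3) C]
  have wf_a: "wf_atom P a" and wf_h: "wf_atom P h" and wf_B: "\<forall>b \<in> set B. wf_atom P b"
    and wf_Q: "\<forall>b \<in> set Q1 \<union> set Q2. wf_atom P b"
    using Q cl by (auto simp: good_query_def)
  have pred_eq: "pred a = pred h" using unif by (metis subst_atom_simps(1))
  have nmq: "linear (outs P (Q1 @ a # Q2))"
    "\<And>A b D. Q1 @ a # Q2 = A @ b # D \<Longrightarrow> vars_in P b \<inter> vars_list (outs P (b # D)) = {}"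
    using Q unfolding good_query_def robustly_typed_query_def nicely_moded_query_iff by blast+
  have nmc: "linear (outs P B)"
    "\<And>A b D. B = A @ b # D \<Longrightarrow> vars_in P b \<inter> vars_list (outs P (b # D)) = {}"
    "vars_in P h \<inter> vars_list (outs P B) = {}"
    using cl(1) unfolding robustly_typed_clause_def nicely_moded_clause_def nicely_moded_query_iff
      vars_list_outs by auto
  have rp_Q: "robust_pos P b i" if "b \<in> insert a (set Q1 \<union> set Q2)" "i \<in> outpos P (pred b)" for b i
    using Q that by (auto simp: good_query_def robustly_typed_query_def)
  have rp_h: "robust_pos P h i" if "i \<in> inpos P (pred h)" for i
    using cl(1) that by (auto simp: robustly_typed_clause_def)
  have rp_B: "robust_pos P b i" if "b \<in> set B" "i \<in> outpos P (pred b)" for b i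
    using cl(1) that by (auto simp: robustly_typed_clause_def)
  have head_out: "(\<exists>k \<in> inpos P (pred h). bound_pos P (pred h) k \<and> args h ! k = Var x) \<or>
      (\<exists>b \<in> set B. \<exists>k \<in> outpos P (pred b). bound_pos P (pred b) k \<and> args b ! k = Var x \<and>
        types P (pred b) ! k = types P (pred h) ! i)"
    if "i \<in> outpos P (pred h)" "bound_pos P (pred h) i" "args h ! i = Var x" for i x
    using cl(1) that unfolding robustly_typed_clause_def clause.sel by blast
  \<comment> \<open>A robustly typed atom has variables in its free output positions, so
    selectability forces its bound inputs to be non-variable. This is what turns input unification
    into matching.\<close>
  have a_nonvar: "\<not> is_variable (args a ! i)" if "i \<in> inpos P (pred h)" "bound_pos P (pred h) i" for i
  proof -
    have "\<forall>i \<in> outpos P (pred a). \<not> bound_pos P (pred a) i \<longrightarrow> is_variable (args a ! i)"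
      using rp_Q[of a] by (auto simp: robust_pos_def)
    then show ?thesis
      using P(4) sel wf_a pred_eq cl(5) that unfolding input_selectability_def by metis
  qed
  have a_out: "vars_in P a \<inter> (vars_out P a \<union> vars_list (outs P Q2)) = {}"
    using nmq(2)[of Q1 a Q2] by simp
  have Q_lin: "vars_out P a \<inter> vars_list (outs P Q1) = {}" "vars_out P a \<inter> vars_list (outs P Q2) = {}"
    "linear (outs P Q1)" "linear (outs P Q2)" "linear (out_args P a)"
    "vars_list (outs P Q1) \<inter> vars_list (outs P Q2) = {}"
    using nmq(1) by (auto simp: linear_append)
  let ?V = "vars_query (h # B)"
  have V: "vars_in P h \<subseteq> ?V" "vars_out P h \<subseteq> ?V" "vars_list (outs P B) \<subseteq> ?V"
    using vars_in_subset[of P h] vars_out_subset[of P h] vars_out_subset[of P]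
    unfolding vars_list_outs by (auto simp: vars_query_def)
  have V_in: "vars_in P b \<subseteq> ?V" if "b \<in> set B" for b
    using vars_in_subset[of P b] that by (auto simp: vars_query_def)
  have a_V: "vars_in P a \<inter> ?V = {}" "vars_out P a \<inter> ?V = {}"
    using apart vars_in_subset[of P a] vars_out_subset[of P a] by auto
  have Q_in_V: "vars_in P b \<inter> ?V = {}" if "b \<in> set Q1 \<union> set Q2" for b
    using apart vars_in_subset[of P b] that by (fastforce simp: vars_query_def)
  have Q_out_V: "vars_list (outs P Q1) \<inter> ?V = {}" "vars_list (outs P Q2) \<inter> ?V = {}"
    using apart vars_out_subset[of P] unfolding vars_list_outs by (fastforce simp: vars_query_def)+
  have "\<exists>\<mu> X. map (\<lambda>t. t \<cdot> \<mu>) (in_args P h) = map (\<lambda>t. t \<cdot> \<mu>) (in_args P a) \<and>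
    map (\<lambda>t. t \<cdot> \<mu>) (out_args P a) = map (\<lambda>t. t \<cdot> \<mu>) (out_args P h) \<and>
    (\<forall>\<tau>. map (\<lambda>t. t \<cdot> \<tau>) (in_args P h) = map (\<lambda>t. t \<cdot> \<tau>) (in_args P a) \<longrightarrow>
      map (\<lambda>t. t \<cdot> \<tau>) (out_args P a) = map (\<lambda>t. t \<cdot> \<tau>) (out_args P h) \<longrightarrow> (\<forall>x. \<mu> x \<cdot> \<tau> = \<tau> x)) \<and>
    X \<subseteq> vars_list (outs P B) \<and>
    (\<forall>x \<in> X. (\<mu> x, Var x) \<in> set (zip (out_args P a) (out_args P h)) \<and> \<not> is_variable (\<mu> x)) \<and>
    (\<forall>x \<in> X. \<forall>y \<in> X. x \<noteq> y \<longrightarrow> set (occs (\<mu> x)) \<inter> set (occs (\<mu> y)) = {}) \<and>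
    (\<forall>x. x \<notin> X \<union> vars_in P h \<union> vars_out P a \<longrightarrow> \<mu> x = Var x) \<and>
    (\<forall>x \<in> vars_in P h. set (occs (\<mu> x)) \<subseteq> vars_in P a) \<and>
    (\<forall>x \<in> vars_out P a. set (occs (\<mu> x)) \<subseteq> vars_in P a \<union> vars_out P h \<union> vars_out P a)"
    (is "\<exists>\<mu> X. ?mgu \<mu> X")
  proof (rule producer_consumer_mgu)
    show "length (in_args P h) = length (in_args P a)" "length (out_args P a) = length (out_args P h)"
      using wf_a wf_h pred_eq by (auto simp: in_args_def out_args_def wf_atom_def intro!: length_nths_eq)
    show "linear (in_args P h)" "linear (out_args P a)" by fact+
    show "flat p' \<and> (is_variable p' \<or> \<not> is_variable s')"
      if ps: "(p', s') \<in> set (zip (in_args P h) (in_args P a))" for p' s'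
    proof -
      from ps obtain i where i: "i \<in> inpos P (pred h)" "p' = args h ! i" "s' = args a ! i"
        using wf_a wf_h pred_eq by (auto simp: set_zip_in_args)
      then show ?thesis
        using rp_h[OF i(1)] robust_pos_flat[of P h i] a_nonvar[OF i(1)]
        by (auto simp: robust_pos_def split: if_splits)
    qed
    show "flat t'" if "t' \<in> set (out_args P a)" for t'
      using that wf_a rp_Q[of a] by (auto simp: set_out_args intro!: robust_pos_flat[of P])
    show "vars_in P h \<inter> vars_in P a = {}"
      using a_V V by blast
    show "vars_out P a \<inter> (vars_in P h \<union> vars_in P a \<union> vars_out P h) = {}"
      using a_V V a_out by blast
    show "vars_list (outs P B) \<inter> (vars_in P h \<union> vars_in P a) = {}"
      using a_V V nmc(3) by blast
    show "x \<in> vars_list (outs P B) \<or>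
        (\<exists>s'. (Var x, s') \<in> set (zip (in_args P h) (in_args P a)) \<and> \<not> is_variable s')"
      if tx: "(t', Var x) \<in> set (zip (out_args P a) (out_args P h))" "\<not> is_variable t'" for t' x
    proof -
      from tx obtain i where i: "i \<in> outpos P (pred h)" "t' = args a ! i" "Var x = args h ! i"
        using wf_a wf_h pred_eq by (auto simp: set_zip_out_args)
      have bd: "bound_pos P (pred h) i"
        using rp_Q[of a i] i tx(2) pred_eq by (auto simp: robust_pos_def split: if_splits)
      from head_out[OF i(1) bd i(3)[symmetric]] show ?thesis
      proof (elim disjE bexE conjE)
        fix k assume k: "k \<in> inpos P (pred h)" "bound_pos P (pred h) k" "args h ! k = Var x"
        then have "(Var x, args a ! k) \<in> set (zip (in_args P h) (in_args P a))"
          unfolding set_zip_in_args[OF wf_h wf_a pred_eq[symmetric]]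
          by (intro CollectI exI[of _ k]) (simp add: pred_eq)
        then show ?thesis using a_nonvar[OF k(1,2)] by blast
      next
        fix b k assume "b \<in> set B" "k \<in> outpos P (pred b)" "args b ! k = Var x"
        then have "x \<in> vars_list (outs P B)"
          using wf_B by (force simp: vars_list_eq set_out_args)
        then show ?thesis ..
      qed
    qed
    show "map (\<lambda>t. t \<cdot> \<theta>) (in_args P h) = map (\<lambda>t. t \<cdot> \<theta>) (in_args P a)"
      "map (\<lambda>t. t \<cdot> \<theta>) (out_args P a) = map (\<lambda>t. t \<cdot> \<theta>) (out_args P h)"
      using unif unifier_iff[OF wf_a wf_h pred_eq] by simp_all
  qed
  then obtain \<mu> X where \<mu>: "?mgu \<mu> X" by (elim exE)
  have unif_\<mu>: "a \<cdot>a \<mu> = h \<cdot>a \<mu>"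
    using \<mu> unfolding unifier_iff[OF wf_a wf_h pred_eq] by (intro conjI; elim conjE)
  have mgu: "\<mu> x \<cdot> \<tau> = \<tau> x" if "a \<cdot>a \<tau> = h \<cdot>a \<tau>" for \<tau> x
    using \<mu> that unfolding unifier_iff[OF wf_a wf_h pred_eq] by blast
  have X: "X \<subseteq> vars_list (outs P B)" using \<mu> by (elim conjE)
  have \<mu>_X: "(\<mu> x, Var x) \<in> set (zip (out_args P a) (out_args P h)) \<and> \<not> is_variable (\<mu> x)"
    if "x \<in> X" for x
    using \<mu> that by blast
  have disj_X: "set (occs (\<mu> x)) \<inter> set (occs (\<mu> y)) = {}" if "x \<in> X" "y \<in> X" "x \<noteq> y" for x y
    using \<mu> that by blast
  have \<mu>_id: "\<mu> x = Var x" if "x \<notin> X \<union> vars_in P h \<union> vars_out P a" for x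
    using \<mu> that by blast
  have \<mu>_in: "set (occs (\<mu> x)) \<subseteq> vars_in P a" if "x \<in> vars_in P h" for x
    using \<mu> that by blast
  have \<mu>_out: "set (occs (\<mu> x)) \<subseteq> vars_in P a \<union> vars_out P h \<union> vars_out P a"
    if "x \<in> vars_out P a" for x
    using \<mu> that by blast
  have X_a: "set (occs (\<mu> x)) \<subseteq> vars_out P a" if "x \<in> X" for x
    using \<mu>_X[OF that] by (auto simp: vars_list_eq dest: set_zip_leftD)
  let ?R = "Q1 @ B @ Q2"
  \<comment> \<open>Dichotomy for an output variable of the unresolved resolvent: it lies in
    \<open>X\<close> and is replaced by an output term of \<open>a\<close>, or it is not touched at
    all.\<close>
  have out_cases: "x \<in> X \<and> x \<in> ?V \<or> x \<notin> vars_out P a \<and> \<mu> x = Var x"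
    if x: "x \<in> vars_list (outs P ?R)" for x
  proof (cases "x \<in> X")
    case False
    have "x \<notin> vars_in P h" "x \<notin> vars_out P a"
      using x V Q_out_V Q_lin a_V nmc(3) by auto
    then show ?thesis using False \<mu>_id by auto
  qed (use X V in auto)
  have lin_R: "linear (outs P (?R \<cdot>q \<mu>))"
    unfolding outs_subst
  proof (rule linear_subst)
    have "vars_list (outs P Q1) \<inter> vars_list (outs P B) = {}" "vars_list (outs P Q2) \<inter> vars_list (outs P B) = {}"
      using Q_out_V V by blast+
    then show "linear (outs P ?R)"
      using Q_lin nmc(1) by (auto simp: linear_append)
  next
    fix x assume x: "x \<in> vars_list (outs P ?R)"
    show "distinct (occs (\<mu> x))"
    proof (cases "x \<in> X")
      case True
      then have "\<mu> x \<in> set (out_args P a)" using \<mu>_X by (auto dest: set_zip_leftD)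
      then show ?thesis
        using wf_a rp_Q[of a] by (auto simp: set_out_args intro!: flat_distinct robust_pos_flat[of P])
    qed (use out_cases[OF x] in auto)
    fix y assume y: "y \<in> vars_list (outs P ?R)" and "x \<noteq> y"
    then show "set (occs (\<mu> x)) \<inter> set (occs (\<mu> y)) = {}"
      using out_cases[OF x] out_cases[OF y] X_a[of x] X_a[of y] disj_X[of x y] by auto
  qed
  \<comment> \<open>By origin of the consumer: left of \<open>a\<close> inputs stay fixed; in the
    body they may turn into inputs of \<open>a\<close>, which avoid the outputs of \<open>a\<close>
    and \<open>Q2\<close>; right of \<open>a\<close> they may use outputs of \<open>a\<close>, whose
    values avoid the output variables of \<open>Q2\<close>.\<close>
  have nm_R: "set (occs (\<mu> z)) \<inter> set (occs (\<mu> y)) = {}"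
    if R: "?R = A @ b # D" and z: "z \<in> vars_in P b" and y: "y \<in> vars_list (outs P (b # D))" for A b D y z
  proof -
    have y_R: "y \<in> vars_list (outs P ?R)" using y R by simp
    consider (q1) E where "Q1 = A @ b # E" "D = E @ B @ Q2"
      | (body) A' E where "A = Q1 @ A'" "B = A' @ b # E" "D = E @ Q2"
      | (q2) A' where "A = Q1 @ B @ A'" "Q2 = A' @ b # D"
      using append_eq_append_Cons[OF R] append_eq_append_Cons[of B Q2 _ b D] R by auto
    then show ?thesis
    proof cases
      case q1
      have n: "vars_in P b \<inter> vars_list (outs P (b # E @ a # Q2)) = {}"
        using nmq(2)[of A b "E @ a # Q2"] q1 by simp
      have z_V: "z \<notin> ?V" "z \<notin> vars_out P a" using Q_in_V[of b] q1 z n by auto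
      have "\<mu> z = Var z" using z_V X V by (intro \<mu>_id) auto
      moreover have "z \<noteq> y" using z_V y n z q1 V by auto
      ultimately show ?thesis using out_cases[OF y_R] X_a[of y] z_V by auto
    next
      case body
      have n: "vars_in P b \<inter> vars_list (outs P (b # E)) = {}"
        using nmc(2) body by blast
      have z_V: "z \<in> ?V" using V_in[of b] z body by auto
      have y': "y \<in> vars_list (outs P (b # E)) \<or> y \<in> vars_list (outs P Q2)"
        using y body by auto
      have "z \<noteq> y" using y' n z z_V Q_out_V by auto
      have z_a: "z \<notin> vars_out P a" using z_V a_V by auto
      have y_a: "y \<notin> vars_in P a"
        using y' a_out a_V V body by auto
      show ?thesis
      proof (cases "z \<in> vars_in P h")
        case True
        then show ?thesis
          using \<mu>_in[OF True] out_cases[OF y_R] X_a[of y] y_a a_out by auto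
      next
        case False
        then have "z \<in> X \<or> \<mu> z = Var z" using \<mu>_id z_a by blast
        then show ?thesis
          using out_cases[OF y_R] X_a[of y] X_a[of z] \<open>z \<noteq> y\<close> disj_X[of z y] z_a by auto
      qed
    next
      case q2
      have n: "vars_in P b \<inter> vars_list (outs P (b # D)) = {}"
        using nmq(2)[of "Q1 @ a # A'" b D] q2 by simp
      have z_V: "z \<notin> ?V" using Q_in_V[of b] q2 z by auto
      have y_Q2: "y \<in> vars_list (outs P Q2)" using y q2 by auto
      then have y_V: "y \<notin> ?V" using Q_out_V by auto
      have \<mu>_y: "\<mu> y = Var y" using out_cases[OF y_R] y_V by auto
      show ?thesis
      proof (cases "z \<in> vars_out P a")
        case True
        then show ?thesis using \<mu>_out[OF True] \<mu>_y y_V V y_Q2 a_out Q_lin by auto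
      next
        case False
        then have "\<mu> z = Var z" using z_V X V by (intro \<mu>_id) auto
        then show ?thesis using \<mu>_y n z y by auto
      qed
    qed
  qed
  have "nicely_moded_query P (?R \<cdot>q \<mu>)"
    unfolding nicely_moded_query_iff
  proof (intro conjI allI impI)
    fix A b D assume "?R \<cdot>q \<mu> = A @ b # D"
    then obtain A' b' D' where R: "?R = A' @ b' # D'" "b = b' \<cdot>a \<mu>" "D = D' \<cdot>q \<mu>"
      using subst_query_eq_append_Cons by blast
    have "b # D = (b' # D') \<cdot>q \<mu>" using R by simp
    then show "vars_in P b \<inter> vars_list (outs P (b # D)) = {}"
      using nm_R[OF R(1)] unfolding R(2) by (simp only: outs_subst vars_list_subst in_args_subst) blast
  qed (rule lin_R)
  moreover have "well_typed_query P (?R \<cdot>q \<mu>)"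
    using Q cl(1)
    by (intro well_typed_resolvent[OF _ _ unif_\<mu>]) (auto simp: good_query_def robustly_typed_query_def robustly_typed_clause_def)
  moreover have "robust_pos P (b \<cdot>a \<mu>) i" if b: "b \<in> set ?R" and i: "i \<in> outpos P (pred b)" for b i
  proof -
    have wf_b: "wf_atom P b" using b wf_B wf_Q by auto
    have i_len: "i < length (args b)" using outpos_less[OF wf_b i] .
    have vars_R: "x \<in> vars_list (outs P ?R)" if "x \<in> set (occs (args b ! i))" for x
      using that b i wf_b unfolding vars_list_outs
      by (intro UN_I[OF b]) (auto simp: vars_list_eq set_out_args)
    show ?thesis
    proof (cases "\<exists>x \<in> set (occs (args b ! i)). x \<in> X")
      case False
      then have "args b ! i \<cdot> \<mu> = args b ! i"
        using out_cases vars_R by (intro subst_trm_id) blast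
      moreover have "robust_pos P b i" using rp_Q rp_B b i by auto
      ultimately show ?thesis using i_len by (simp add: robust_pos_def)
    next
      case True
      then obtain x where x: "x \<in> set (occs (args b ! i))" "x \<in> X" by blast
      have "b \<notin> set Q1 \<union> set Q2"
      proof
        assume "b \<in> set Q1 \<union> set Q2"
        then have "x \<in> vars_list (outs P Q1) \<union> vars_list (outs P Q2)"
          using x(1) i wf_b unfolding vars_list_outs by (force simp: vars_list_eq set_out_args)
        then show False using x(2) X V Q_out_V by blast
      qed
      then have b_B: "b \<in> set B" using b by auto
      from \<mu>_X[OF x(2)] obtain j where j: "j \<in> outpos P (pred h)" "\<mu> x = args a ! j" "args h ! j = Var x"
        using wf_a wf_h pred_eq by (auto simp: set_zip_out_args)
      have bd: "bound_pos P (pred h) j"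
        using rp_Q[of a j] \<mu>_X[OF x(2)] j pred_eq by (auto simp: robust_pos_def split: if_splits)
      have "\<not> (\<exists>k \<in> inpos P (pred h). bound_pos P (pred h) k \<and> args h ! k = Var x)"
      proof clarify
        fix k assume "k \<in> inpos P (pred h)" "args h ! k = Var x"
        then have "x \<in> vars_in P h" using wf_h by (force simp: vars_list_eq set_in_args)
        then show False using x(2) X nmc(3) by blast
      qed
      \<comment> \<open>The variable \<open>x\<close> cannot be an input of the head, so robust
        typing of the clause places it alone in a bound output position of the body, of the same
        type as the head position. By uniqueness this is position \<open>i\<close> of
        \<open>b\<close>, and type-consistency of \<open>\<mu> x\<close> carries over.\<close>
      then obtain c k where c: "c \<in> set B" "k \<in> outpos P (pred c)" "bound_pos P (pred c) k"
        "args c ! k = Var x" "types P (pred c) ! k = types P (pred h) ! j"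
        using head_out[OF j(1) bd j(3)] by blast
      have "c = b \<and> k = i"
        by (rule linear_outs_unique[OF nmc(1) wf_B c(1) b_B c(2) i, of x]) (use c(4) x(1) in auto)
      moreover have "flat (\<mu> x) \<and> type_consistent (\<mu> x) (types P (pred h) ! j)"
        using rp_Q[of a j] bd j pred_eq by (auto simp: robust_pos_def)
      ultimately show ?thesis using c i_len by (simp add: robust_pos_def)
    qed
  qed
  ultimately have "good_query P (?R \<cdot>q \<mu>)"
    using wf_B wf_Q by (auto simp: good_query_def robustly_typed_query_def)
  moreover have "\<mu> x = Var x" if "x \<notin> vars_out P a \<union> ?V" for x
    using that X V by (intro \<mu>_id) auto
  moreover have "set (occs (\<mu> x)) \<subseteq> vars_atom a \<union> ?V" if x: "x \<in> vars_out P a \<union> ?V" for x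
  proof -
    from x consider "x \<in> X" | "x \<in> vars_in P h" | "x \<in> vars_out P a" | "\<mu> x = Var x" "x \<in> ?V"
      using \<mu>_id[of x] by blast
    then show ?thesis
      using X_a[of x] \<mu>_in[of x] \<mu>_out[of x] V vars_in_subset[of P a] vars_out_subset[of P a]
      by cases auto
  qed
  ultimately show ?thesis using unif_\<mu> mgu by blast
qed

section \<open>Termination and derivation steps\<close>

definition step :: "('f, 'v, 'p) program \<Rightarrow> ('f, 'v, 'p) query \<Rightarrow> ('f, 'v, 'p) query \<Rightarrow> bool" where
  "step P Q Q' \<longleftrightarrow> (\<exists>a. selectable P a \<and> deriv_step P a Q Q')"

abbreviation terminating :: "('f, 'v, 'p) program \<Rightarrow> ('f, 'v, 'p) query \<Rightarrow> bool" where
  "terminating P \<equiv> Wellfounded.accp (\<lambda>Q' Q. step P Q Q')"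

text \<open>In one direction an infinite derivation is pushed along the well-founded part; in the
  other, a choice function repeatedly picks a non-terminating successor.\<close>

lemma terminating_iff:
  "terminating P Q \<longleftrightarrow> \<not> (\<exists>d. infinite_delay_respecting_derivation P Q d)"
proof
  assume "terminating P Q"
  then show "\<not> (\<exists>d. infinite_delay_respecting_derivation P Q d)"
  proof (induction rule: accp_induct_rule)
    case (1 Q)
    show ?case
    proof
      assume "\<exists>d. infinite_delay_respecting_derivation P Q d"
      then obtain d where d: "infinite_delay_respecting_derivation P Q d" by blast
      then have "step P Q (d 1)"
        unfolding infinite_delay_respecting_derivation_def step_def by (metis One_nat_def)
      moreover have "infinite_delay_respecting_derivation P (d 1) (\<lambda>i. d (Suc i))"
        using d by (simp add: infinite_delay_respecting_derivation_def)
      ultimately show False using 1 by blast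
    qed
  qed
next
  assume nd: "\<not> (\<exists>d. infinite_delay_respecting_derivation P Q d)"
  show "terminating P Q"
  proof (rule ccontr)
    assume nt: "\<not> terminating P Q"
    have "\<forall>Q. \<exists>Q'. \<not> terminating P Q \<longrightarrow> step P Q Q' \<and> \<not> terminating P Q'"
      by (meson accp.accI)
    then obtain f where f: "\<And>Q. \<not> terminating P Q \<Longrightarrow> step P Q (f Q) \<and> \<not> terminating P (f Q)"
      by metis
    have "\<not> terminating P ((f ^^ i) Q)" for i
      using nt f by (induction i) auto
    then have "infinite_delay_respecting_derivation P Q (\<lambda>i. (f ^^ i) Q)"
      using f by (auto simp: infinite_delay_respecting_derivation_def step_def)
    then show False using nd by blast
  qed
qed

lemma robust_iff_terminating:
  "robust P q \<longleftrightarrow> (\<forall>a. wf_atom P a \<and> pred a = q \<and> robustly_typed_query P [a] \<longrightarrow> terminating P [a])"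
  unfolding robust_def terminating_iff ..

section \<open>Steps under renaming\<close>

lemma variant_of_rename:
  assumes "variant_of (Clause h B) C" "bij \<pi>"
  shows "variant_of (Clause (h \<cdot>a (\<lambda>x. Var (\<pi> x))) (B \<cdot>q (\<lambda>x. Var (\<pi> x)))) C"
proof -
  obtain \<rho> where \<rho>: "bij \<rho>" "h = head C \<cdot>a (\<lambda>x. Var (\<rho> x))" "B = body C \<cdot>q (\<lambda>x. Var (\<rho> x))"
    using assms(1) by (auto simp: variant_of_def)
  have "bij (\<pi> \<circ> \<rho>)" using \<rho>(1) assms(2) by (simp add: bij_comp)
  then show ?thesis
    unfolding variant_of_def \<rho>(2,3) subst_atom_comp[symmetric] subst_query_comp[symmetric]
    by (intro exI[of _ "\<pi> \<circ> \<rho>"]) (simp add: subst_comp_def)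
qed

lemma is_variable_rename: "is_variable (t \<cdot> (\<lambda>x. Var (\<rho> x))) \<longleftrightarrow> is_variable t"
  by (cases t) auto

text \<open>Block declarations only test whether arguments are variables, and instantiation can turn
  a variable into a non-variable term but not conversely.\<close>

lemma selectable_subst: "wf_atom P a \<Longrightarrow> selectable P a \<Longrightarrow> selectable P (a \<cdot>a \<sigma>)"
  unfolding selectable_def blocked_def
  by (auto simp: wf_atom_def) (metis not_is_variable_subst)

lemma selectable_rename: "wf_atom P a \<Longrightarrow> selectable P (a \<cdot>a (\<lambda>x. Var (\<rho> x))) \<longleftrightarrow> selectable P a"
  by (auto simp: selectable_def blocked_def is_variable_rename wf_atom_def)

text \<open>The resolvent is literally the same: the renaming is absorbed into the mgu and the
  clause variant is pulled back along the inverse. A renamed query thus has no resolvents beyond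
  those of the original, and its termination follows without an induction.\<close>

lemma step_rename:
  fixes P :: "('f, 'v, 'p) program"
  assumes bij: "bij \<pi>" and wf: "\<forall>a \<in> set Q. wf_atom P a"
    and st: "step P (Q \<cdot>q (\<lambda>x. Var (\<pi> x))) Q'"
  shows "step P Q Q'"
proof -
  define v :: "('f, 'v) subst" where "v = (\<lambda>x. Var (\<pi> x))"
  define w :: "('f, 'v) subst" where "w = (\<lambda>x. Var (inv \<pi> x))"
  have vw: "subst_comp v w = Var" "subst_comp w v = Var"
    using bij by (auto simp: subst_comp_def v_def w_def bij_is_inj bij_is_surj surj_f_inv_f)
  obtain a Q1 Q2 C h B \<theta> where st': "selectable P a" "Q \<cdot>q v = Q1 @ a # Q2" "C \<in> clauses P"
    "variant_of (Clause h B) C" "vars_query (h # B) \<inter> vars_query (Q \<cdot>q v) = {}" "is_mgu \<theta> a h"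
    "Q' = (Q1 @ B @ Q2) \<cdot>q \<theta>"
    using st unfolding step_def deriv_step_def v_def by auto
  obtain R1 b R2 where Q: "Q = R1 @ b # R2" and ren: "Q1 = R1 \<cdot>q v" "a = b \<cdot>a v" "Q2 = R2 \<cdot>q v"
    using subst_query_eq_append_Cons[OF st'(2)] by blast
  define \<theta>' where "\<theta>' = subst_comp v \<theta>"
  have hw: "h \<cdot>a w \<cdot>a v = h" "B \<cdot>q w \<cdot>q v = B"
    by (simp_all add: subst_atom_comp[symmetric] subst_query_comp[symmetric] vw subst_atom_Var subst_query_Var)
  have "variant_of (Clause (h \<cdot>a w) (B \<cdot>q w)) C"
    unfolding w_def using st'(4) bij by (intro variant_of_rename bij_imp_bij_inv)
  moreover have "vars_query (h \<cdot>a w # B \<cdot>q w) \<inter> vars_query Q = {}"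
  proof -
    have "\<pi> ` (vars_query (h \<cdot>a w # B \<cdot>q w) \<inter> vars_query Q) \<subseteq>
      vars_query ((h \<cdot>a w # B \<cdot>q w) \<cdot>q v) \<inter> vars_query (Q \<cdot>q v)"
      unfolding vars_query_subst by (auto simp: v_def)
    also have "(h \<cdot>a w # B \<cdot>q w) \<cdot>q v = h # B" by (simp add: hw)
    finally show ?thesis using st'(5) by auto
  qed
  moreover have "is_mgu \<theta>' b (h \<cdot>a w)"
    unfolding is_mgu_def
  proof (intro conjI allI impI)
    show "b \<cdot>a \<theta>' = h \<cdot>a w \<cdot>a \<theta>'"
      using st'(6) by (simp add: \<theta>'_def subst_atom_comp hw ren(2) is_mgu_def)
    fix \<sigma> assume "b \<cdot>a \<sigma> = h \<cdot>a w \<cdot>a \<sigma>"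
    moreover have "b \<cdot>a v \<cdot>a w = b"
      by (simp add: subst_atom_comp[symmetric] vw subst_atom_Var)
    ultimately have "a \<cdot>a subst_comp w \<sigma> = h \<cdot>a subst_comp w \<sigma>"
      by (simp add: ren(2) subst_atom_comp)
    then obtain \<rho> where \<rho>: "subst_comp w \<sigma> = subst_comp \<theta> \<rho>"
      using st'(6) unfolding is_mgu_def by blast
    have assoc: "subst_comp (subst_comp r s) t = subst_comp r (subst_comp s t)" for r s t :: "('f, 'v) subst"
      by (simp add: subst_comp_def subst_trm_comp[unfolded subst_comp_def])
    have "subst_comp Var \<sigma> = \<sigma>" by (simp add: subst_comp_def)
    then have "\<sigma> = subst_comp v (subst_comp w \<sigma>)" by (simp add: assoc[symmetric] vw)
    then show "\<exists>\<rho>. \<sigma> = subst_comp \<theta>' \<rho>" unfolding \<rho> \<theta>'_def by (metis assoc)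
  qed
  moreover have "Q' = (R1 @ B \<cdot>q w @ R2) \<cdot>q \<theta>'"
    by (simp add: st'(7) \<theta>'_def subst_query_comp ren hw)
  moreover have "selectable P b"
    using st'(1) wf Q unfolding ren(2) v_def by (simp add: selectable_rename)
  ultimately show ?thesis
    using st'(3) Q unfolding step_def deriv_step_def by fastforce
qed

lemma terminating_rename:
  assumes "terminating P Q" "bij \<pi>" "\<forall>a \<in> set Q. wf_atom P a"
  shows "terminating P (Q \<cdot>q (\<lambda>x. Var (\<pi> x)))"
proof (rule accp.accI)
  fix Q' assume "step P (Q \<cdot>q (\<lambda>x. Var (\<pi> x))) Q'"
  then have "step P Q Q'" using step_rename[OF assms(2,3)] by blast
  then show "terminating P Q'" using accp_downward[OF assms(1)] by blast
qed

section \<open>Canonical steps\<close>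

text \<open>A normal form of a step. Absorption by every unifier makes \<open>\<mu>\<close> an
  idempotent mgu, and the bounds on its domain and range mention only the selected atom and the
  clause. The surrounding query does not influence it, so the same \<open>\<mu>\<close> can be
  reused after atoms are dropped.\<close>

definition canonical_step ::
  "('f, 'v, 'p) program \<Rightarrow> ('f, 'v, 'p) query \<Rightarrow> ('f, 'v, 'p) atom \<Rightarrow> ('f, 'v, 'p) query \<Rightarrow>
    ('f, 'v, 'p) clause \<Rightarrow> ('f, 'v, 'p) atom \<Rightarrow> ('f, 'v, 'p) query \<Rightarrow> ('f, 'v) subst \<Rightarrow> bool"
where
  "canonical_step P Q1 a Q2 C h B \<mu> \<longleftrightarrow>
    selectable P a \<and> C \<in> clauses P \<and> variant_of (Clause h B) C \<and>
    vars_query (h # B) \<inter> vars_query (Q1 @ a # Q2) = {} \<and>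
    a \<cdot>a \<mu> = h \<cdot>a \<mu> \<and> (\<forall>\<tau>. a \<cdot>a \<tau> = h \<cdot>a \<tau> \<longrightarrow> (\<forall>x. \<mu> x \<cdot> \<tau> = \<tau> x)) \<and>
    (\<forall>x. x \<notin> vars_out P a \<union> vars_query (h # B) \<longrightarrow> \<mu> x = Var x) \<and>
    (\<forall>x \<in> vars_out P a \<union> vars_query (h # B). set (occs (\<mu> x)) \<subseteq> vars_atom a \<union> vars_query (h # B)) \<and>
    good_query P (Q1 @ a # Q2) \<and> good_query P ((Q1 @ B @ Q2) \<cdot>q \<mu>)"

lemma idempotent_is_mgu:
  assumes "a \<cdot>a \<mu> = h \<cdot>a \<mu>" "\<And>\<tau> x. a \<cdot>a \<tau> = h \<cdot>a \<tau> \<Longrightarrow> \<mu> x \<cdot> \<tau> = \<tau> x"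
  shows "is_mgu \<mu> a h"
  unfolding is_mgu_def subst_comp_def using assms by (metis ext)

text \<open>The given mgu and the canonical one are instances of each other, so they differ on the
  variables of the resolvent only by an injective renaming, which extends to a bijection of all
  variables.\<close>

lemma step_canonical:
  assumes P: "wf_program P" "robustly_typed_program P" "input_linear_program P" "input_selectability P"
    and Q: "good_query P Q" and st: "step P Q Q'"
  shows "\<exists>Q1 a Q2 C h B \<mu> \<pi>. Q = Q1 @ a # Q2 \<and> canonical_step P Q1 a Q2 C h B \<mu> \<and>
    bij \<pi> \<and> Q' = (Q1 @ B @ Q2) \<cdot>q \<mu> \<cdot>q (\<lambda>x. Var (\<pi> x))"
proof -
  obtain a Q1 Q2 C h B \<theta> where st': "selectable P a" "Q = Q1 @ a # Q2" "C \<in> clauses P"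
    "variant_of (Clause h B) C" "vars_query (h # B) \<inter> vars_query (Q1 @ a # Q2) = {}" "is_mgu \<theta> a h"
    "Q' = (Q1 @ B @ Q2) \<cdot>q \<theta>"
    using st unfolding step_def deriv_step_def by auto
  have unif: "a \<cdot>a \<theta> = h \<cdot>a \<theta>" using st'(6) by (simp add: is_mgu_def)
  obtain \<mu> where \<mu>: "canonical_step P Q1 a Q2 C h B \<mu>"
    using canonical_resolvent[OF P Q[unfolded st'(2)] st'(1,3,4,5) unif] Q st'
    unfolding canonical_step_def by blast
  let ?R = "(Q1 @ B @ Q2) \<cdot>q \<mu>"
  have "a \<cdot>a \<mu> = h \<cdot>a \<mu>" using \<mu> by (simp add: canonical_step_def)
  then obtain \<rho> where \<rho>: "\<mu> = subst_comp \<theta> \<rho>" using st'(6) unfolding is_mgu_def by blast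
  \<comment> \<open>Since \<open>\<mu>\<close> is absorbed by every unifier, \<open>\<theta>\<close>
    applied after \<open>\<mu>\<close> changes nothing; so \<open>Q'\<close> is the canonical
    resolvent instantiated by \<open>\<theta>\<close>, and \<open>\<rho>\<close> undoes this
    instantiation.\<close>
  have "subst_comp \<mu> \<theta> = \<theta>"
    using \<mu> unif by (auto simp: canonical_step_def subst_comp_def)
  then have Q': "Q' = ?R \<cdot>q \<theta>" using st'(7) by (metis subst_query_comp)
  have "?R \<cdot>q subst_comp \<theta> \<rho> = ?R \<cdot>q Var"
    using Q' st'(7) by (simp only: subst_query_Var) (metis \<rho> subst_query_comp)
  then have inv: "\<theta> x \<cdot> \<rho> = Var x" if "x \<in> vars_query ?R" for x
    using that unfolding subst_query_cong_iff by (simp add: subst_comp_def)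
  then have "\<forall>x \<in> vars_query ?R. \<exists>y. \<theta> x = Var y"
    by (metis is_variable_iff not_is_variable_subst)
  then obtain \<rho>' where \<rho>': "\<And>x. x \<in> vars_query ?R \<Longrightarrow> \<theta> x = Var (\<rho>' x)" by metis
  have "inj_on \<rho>' (vars_query ?R)"
    by (rule inj_onI) (metis \<rho>' inv trm.inject(1))
  then obtain \<pi> where \<pi>: "bij \<pi>" "\<And>x. x \<in> vars_query ?R \<Longrightarrow> \<pi> x = \<rho>' x"
    using extend_to_bij[OF finite_vars_query] by metis
  have "Q' = ?R \<cdot>q (\<lambda>x. Var (\<pi> x))"
    unfolding Q' subst_query_cong_iff using \<rho>' \<pi>(2) by simp
  then show ?thesis using st'(2) \<mu> \<pi>(1) by blast
qed

lemma terminatingI_canonical: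
  assumes P: "wf_program P" "robustly_typed_program P" "input_linear_program P" "input_selectability P"
    and Q: "good_query P Q"
    and resolvents: "\<And>Q1 a Q2 C h B \<mu>. Q = Q1 @ a # Q2 \<Longrightarrow> canonical_step P Q1 a Q2 C h B \<mu> \<Longrightarrow>
      terminating P ((Q1 @ B @ Q2) \<cdot>q \<mu>)"
  shows "terminating P Q"
proof (rule accp.accI)
  fix Q' assume "step P Q Q'"
  then obtain Q1 a Q2 C h B \<mu> \<pi> where cs: "Q = Q1 @ a # Q2" "canonical_step P Q1 a Q2 C h B \<mu>"
    "bij \<pi>" "Q' = (Q1 @ B @ Q2) \<cdot>q \<mu> \<cdot>q (\<lambda>x. Var (\<pi> x))"
    using step_canonical[OF P Q] by blast
  have "\<forall>b \<in> set ((Q1 @ B @ Q2) \<cdot>q \<mu>). wf_atom P b"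
    using cs(2) unfolding canonical_step_def good_query_def by blast
  then show "terminating P Q'"
    unfolding cs(4) using resolvents[OF cs(1,2)] cs(3) by (intro terminating_rename)
qed

lemma canonical_step_prefix:
  assumes "canonical_step P Q1 a (Q2 @ G) C h B \<mu>"
  shows "step P (Q1 @ a # Q2) ((Q1 @ B @ Q2) \<cdot>q \<mu>)"
  using assms idempotent_is_mgu[of a \<mu> h]
  unfolding canonical_step_def step_def deriv_step_def
  by (intro exI[of _ a] conjI exI[of _ Q1] exI[of _ Q2] exI[of _ C] exI[of _ h] exI[of _ B] exI[of _ \<mu>]) auto

text \<open>The renamed variables \<open>N\<close> stay independent of everything that \<open>\<delta>\<close> puts in place of the
  other variables.\<close>

definition renames_apart :: "('f, 'v) subst \<Rightarrow> 'v set \<Rightarrow> bool" where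
  "renames_apart \<delta> N \<longleftrightarrow> (\<exists>\<rho>. inj_on \<rho> N \<and> (\<forall>x \<in> N. \<delta> x = Var (\<rho> x)) \<and>
    (\<forall>z. z \<notin> N \<longrightarrow> \<rho> ` N \<inter> set (occs (\<delta> z)) = {}))"

lemma renames_apart_subset:
  assumes "renames_apart \<delta> M" "N \<subseteq> M"
  shows "renames_apart \<delta> N"
proof -
  obtain \<rho> where \<rho>: "inj_on \<rho> M" "\<forall>x \<in> M. \<delta> x = Var (\<rho> x)"
    "\<forall>z. z \<notin> M \<longrightarrow> \<rho> ` M \<inter> set (occs (\<delta> z)) = {}"
    using assms(1) by (auto simp: renames_apart_def)
  have "\<rho> ` N \<inter> set (occs (\<delta> z)) = {}" if "z \<notin> N" for z
  proof (cases "z \<in> M")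
    case True
    then have "\<rho> z \<notin> \<rho> ` N"
      using \<rho>(1) assms(2) that by (metis inj_on_image_mem_iff)
    then show ?thesis using True \<rho>(2) by simp
  next
    case False
    then show ?thesis using \<rho>(3) assms(2) by blast
  qed
  then show ?thesis
    unfolding renames_apart_def using \<rho>(1,2) assms(2)
    by (intro exI[of _ \<rho>]) (auto intro: inj_on_subset)
qed

text \<open>The new variables \<open>E\<close> are sent to variables that do not occur in the values
  already fixed on \<open>N\<close> and \<open>K\<close>. This makes room for the variables that a
  clause variant brings in.\<close>

lemma renames_apart_extend:
  fixes N K E :: "'v::infinite set"
  assumes "renames_apart \<delta> N" "finite N" "finite K" "finite E" "E \<inter> K = {}"
  shows "\<exists>\<delta>'. (\<forall>x \<in> N \<union> K. \<delta>' x = \<delta> x) \<and> renames_apart \<delta>' (N \<union> E)"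
proof -
  obtain \<rho> where \<rho>: "inj_on \<rho> N" "\<forall>x \<in> N. \<delta> x = Var (\<rho> x)"
    "\<forall>z. z \<notin> N \<longrightarrow> \<rho> ` N \<inter> set (occs (\<delta> z)) = {}"
    using assms(1) by (auto simp: renames_apart_def)
  let ?D = "\<Union>x \<in> N \<union> K. set (occs (\<delta> x))"
  obtain f :: "'v \<Rightarrow> 'v" where f: "inj_on f E" "f ` E \<inter> ?D = {}"
    using fresh_injection[of E ?D] assms(2-4) by blast
  \<comment> \<open>All other variables go to a ground term, since being renamed apart also
    restricts the values of variables that do not occur in the queries at hand.\<close>
  define \<delta>' where "\<delta>' x = (if x \<in> N \<union> K then \<delta> x else if x \<in> E then Var (f x) else Fun undefined [])" for x
  define \<rho>' where "\<rho>' x = (if x \<in> N then \<rho> x else f x)" for x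
  have \<rho>_D: "\<rho> x \<in> ?D" if "x \<in> N" for x
    using that \<rho>(2) by (intro UN_I[of x]) auto
  have "inj_on \<rho>' (N \<union> E)"
  proof (rule inj_onI)
    fix x y assume xy: "x \<in> N \<union> E" "y \<in> N \<union> E" "\<rho>' x = \<rho>' y"
    have fE: "f z \<notin> ?D" if "z \<in> E" for z using f(2) that by blast
    show "x = y"
      using xy \<rho>_D[of x] \<rho>_D[of y] fE[of x] fE[of y] \<rho>(1) f(1)
      by (cases "x \<in> N"; cases "y \<in> N") (auto simp: \<rho>'_def dest: inj_onD)
  qed
  moreover have "\<delta>' x = Var (\<rho>' x)" if "x \<in> N \<union> E" for x
    using that \<rho>(2) assms(5) by (auto simp: \<delta>'_def \<rho>'_def)
  moreover have "\<rho>' ` (N \<union> E) \<inter> set (occs (\<delta>' z)) = {}" if "z \<notin> N \<union> E" for z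
  proof (cases "z \<in> K")
    case True
    have "\<rho>' ` (N \<union> E) \<subseteq> \<rho> ` N \<union> f ` E" by (auto simp: \<rho>'_def)
    moreover have "\<rho> ` N \<inter> set (occs (\<delta> z)) = {}" using \<rho>(3) that by blast
    moreover have "f ` E \<inter> set (occs (\<delta> z)) = {}" using f(2) True by blast
    ultimately have "\<rho>' ` (N \<union> E) \<inter> set (occs (\<delta> z)) = {}" by blast
    then show ?thesis using True by (simp add: \<delta>'_def)
  qed (use that in \<open>auto simp: \<delta>'_def\<close>)
  ultimately have "renames_apart \<delta>' (N \<union> E)"
    unfolding renames_apart_def by blast
  then show ?thesis by (intro exI[of _ \<delta>']) (simp add: \<delta>'_def)
qed

lemma canonical_step_subst:
  fixes P :: "('f, 'v, 'p) program"
  assumes cs: "canonical_step P (F @ Q1) a Q2 C h B \<mu>"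
    and ren: "renames_apart \<sigma> M" and M: "vars_out P a \<union> vars_query (h # B) \<subseteq> M"
  shows "step P ((Q1 @ a # Q2) \<cdot>q \<sigma>) ((Q1 @ B @ Q2) \<cdot>q \<mu> \<cdot>q \<sigma>)"
proof -
  let ?V = "vars_query (h # B)"
  let ?T = "vars_out P a \<union> ?V"
  note cs' = cs[unfolded canonical_step_def]
  obtain \<rho> where \<rho>: "inj_on \<rho> ?T" "\<forall>x \<in> ?T. \<sigma> x = Var (\<rho> x)"
    "\<forall>z. z \<notin> ?T \<longrightarrow> \<rho> ` ?T \<inter> set (occs (\<sigma> z)) = {}"
    using renames_apart_subset[OF ren M] unfolding renames_apart_def by blast
  \<comment> \<open>The transport of \<open>\<mu>\<close> along \<open>\<sigma>\<close>, chosen so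
    that \<open>\<theta>\<close> after \<open>\<sigma>\<close> equals \<open>\<sigma>\<close> after
    \<open>\<mu>\<close>. The resolvent of the instance is then the instance of the
    resolvent.\<close>
  define \<theta> where "\<theta> y = (if y \<in> \<rho> ` ?T then \<mu> (inv_into ?T \<rho> y) \<cdot> \<sigma> else Var y)" for y
  have comm: "\<sigma> x \<cdot> \<theta> = \<mu> x \<cdot> \<sigma>" for x
  proof (cases "x \<in> ?T")
    case True
    then have "\<theta> (\<rho> x) = \<mu> x \<cdot> \<sigma>"
      using \<rho>(1) unfolding \<theta>_def by (simp only: inv_into_f_f image_eqI if_True)
    then show ?thesis using \<rho>(2) True by simp
  next
    case False
    then have "\<sigma> x \<cdot> \<theta> = \<sigma> x"
      using \<rho>(3) by (intro subst_trm_id) (auto simp: \<theta>_def)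
    moreover have "\<mu> x = Var x" using cs' False by blast
    ultimately show ?thesis by simp
  qed
  have comm': "subst_comp \<sigma> \<theta> = subst_comp \<mu> \<sigma>" by (simp add: subst_comp_def comm)
  have comm_a: "b \<cdot>a \<sigma> \<cdot>a \<theta> = b \<cdot>a \<mu> \<cdot>a \<sigma>" for b :: "('f, 'v, 'p) atom"
    using comm' by (metis subst_atom_comp)
  have comm_q: "Q \<cdot>q \<sigma> \<cdot>q \<theta> = Q \<cdot>q \<mu> \<cdot>q \<sigma>" for Q :: "('f, 'v, 'p) query"
    using comm' by (metis subst_query_comp)
  have mgu: "is_mgu \<theta> (a \<cdot>a \<sigma>) (h \<cdot>a \<sigma>)"
  proof (rule idempotent_is_mgu)
    show "a \<cdot>a \<sigma> \<cdot>a \<theta> = h \<cdot>a \<sigma> \<cdot>a \<theta>" using cs' by (simp add: comm_a)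
    fix \<tau> y assume "a \<cdot>a \<sigma> \<cdot>a \<tau> = h \<cdot>a \<sigma> \<cdot>a \<tau>"
    then have "a \<cdot>a subst_comp \<sigma> \<tau> = h \<cdot>a subst_comp \<sigma> \<tau>" by (simp add: subst_atom_comp)
    then have abs: "\<mu> x \<cdot> subst_comp \<sigma> \<tau> = subst_comp \<sigma> \<tau> x" for x using cs' by blast
    show "\<theta> y \<cdot> \<tau> = \<tau> y"
    proof (cases "y \<in> \<rho> ` ?T")
      case True
      then obtain x where x: "x \<in> ?T" "y = \<rho> x" by blast
      then have "\<sigma> x = Var y" using \<rho>(2) by blast
      then have "\<theta> y = \<mu> x \<cdot> \<sigma>" using comm[of x] by simp
      then show ?thesis using abs[of x] \<open>\<sigma> x = Var y\<close> by (simp add: subst_trm_comp) (simp add: subst_comp_def)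
    next
      case False
      then show ?thesis unfolding \<theta>_def by simp
    qed
  qed
  have "inj_on \<rho> ?V" using \<rho>(1) by (rule inj_on_subset) blast
  then obtain \<pi> where \<pi>: "bij \<pi>" "\<And>x. x \<in> ?V \<Longrightarrow> \<pi> x = \<rho> x"
    using extend_to_bij[OF finite_vars_query] by metis
  have "(h # B) \<cdot>q \<sigma> = (h # B) \<cdot>q (\<lambda>x. Var (\<pi> x))"
    unfolding subst_query_cong_iff using \<pi>(2) \<rho>(2) by simp
  then have var: "variant_of (Clause (h \<cdot>a \<sigma>) (B \<cdot>q \<sigma>)) C"
    using variant_of_rename[of h B C \<pi>] cs' \<pi>(1) by simp
  have apart: "vars_query ((h # B) \<cdot>q \<sigma>) \<inter> vars_query ((Q1 @ a # Q2) \<cdot>q \<sigma>) = {}"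
  proof -
    have "\<rho> x \<notin> set (occs (\<sigma> z))" if "x \<in> ?V" "z \<in> vars_query (Q1 @ a # Q2)" for x z
    proof (cases "z \<in> ?T")
      case True
      have "z \<notin> ?V" using that(2) cs' by auto
      then have "\<rho> x \<noteq> \<rho> z" using inj_onD[OF \<rho>(1), of x z] True that(1) by auto
      then show ?thesis using True \<rho>(2) by simp
    next
      case False
      then show ?thesis using \<rho>(3) that(1) by blast
    qed
    moreover have "set (occs (\<sigma> x)) = {\<rho> x}" if "x \<in> ?V" for x using \<rho>(2) that by simp
    ultimately show ?thesis unfolding vars_query_subst by fastforce
  qed
  have "wf_atom P a" using cs' by (simp add: good_query_def)
  then have "selectable P (a \<cdot>a \<sigma>)" using cs' by (intro selectable_subst) blast+
  then show ?thesis
    unfolding step_def deriv_step_def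
    using cs' var apart mgu
    by (intro exI[of _ "a \<cdot>a \<sigma>"] conjI exI[of _ "Q1 \<cdot>q \<sigma>"] exI[of _ "Q2 \<cdot>q \<sigma>"] exI[of _ C]
        exI[of _ "h \<cdot>a \<sigma>"] exI[of _ "B \<cdot>q \<sigma>"] exI[of _ \<theta>]) (simp_all add: comm_q)
qed

section \<open>Producers and consumers\<close>

text \<open>Types are closed under instantiation, so a constant can be put in for all variables.
  Groundness ensures that values invented for unfinished outputs cannot clash with variables of the
  consumers.\<close>

lemma type_has_ground_term:
  assumes "is_type T" "t \<in> T"
  shows "\<exists>\<gamma>. t \<cdot> \<gamma> \<in> T \<and> (\<forall>x. occs (\<gamma> x) = [])"
  using assms by (intro exI[of _ "\<lambda>_. Fun undefined []"]) (simp add: is_type_def)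

text \<open>Linearity allows a typed ground instance to be chosen independently for each term;
  type-consistency of every term supplies it.\<close>

lemma linear_type_instance:
  assumes "linear (map fst ps)" "\<forall>(t, T) \<in> set ps. is_type T \<and> type_consistent t T"
  shows "\<exists>\<sigma>. (\<forall>(t, T) \<in> set ps. t \<cdot> \<sigma> \<in> T) \<and>
    (\<forall>x. x \<in> vars_list (map fst ps) \<longrightarrow> occs (\<sigma> x) = []) \<and>
    (\<forall>x. x \<notin> vars_list (map fst ps) \<longrightarrow> \<sigma> x = Var x)"
  using assms
proof (induction ps)
  case Nil
  show ?case by (intro exI[of _ Var]) (simp add: vars_list_def)
next
  case (Cons p ps)
  obtain t T where p: "p = (t, T)" by fastforce
  have lin: "linear (map fst ps)" "set (occs t) \<inter> vars_list (map fst ps) = {}"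
    using Cons.prems(1) p by (auto simp: linear_def vars_list_def)
  obtain \<sigma> where \<sigma>: "\<forall>(t, T) \<in> set ps. t \<cdot> \<sigma> \<in> T"
    "\<forall>x. x \<in> vars_list (map fst ps) \<longrightarrow> occs (\<sigma> x) = []"
    "\<forall>x. x \<notin> vars_list (map fst ps) \<longrightarrow> \<sigma> x = Var x"
    using Cons.IH[OF lin(1)] Cons.prems(2) by auto
  obtain \<tau> where "is_type T" "t \<cdot> \<tau> \<in> T"
    using Cons.prems(2) p by (auto simp: type_consistent_def)
  then obtain \<gamma> where \<gamma>: "t \<cdot> \<tau> \<cdot> \<gamma> \<in> T" "\<forall>x. occs (\<gamma> x) = []"
    using type_has_ground_term by metis
  define \<sigma>' where "\<sigma>' x = (if x \<in> set (occs t) then \<tau> x \<cdot> \<gamma> else \<sigma> x)" for x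
  have "t \<cdot> \<sigma>' = t \<cdot> subst_comp \<tau> \<gamma>"
    unfolding subst_trm_cong_iff by (simp add: \<sigma>'_def subst_comp_def)
  then have "t \<cdot> \<sigma>' \<in> T" using \<gamma>(1) by (simp add: subst_trm_comp)
  moreover have "u \<cdot> \<sigma>' = u \<cdot> \<sigma>" if "(u, U) \<in> set ps" for u U
  proof -
    have "set (occs u) \<subseteq> vars_list (map fst ps)" using that by (force simp: vars_list_eq)
    then show ?thesis using lin(2) unfolding subst_trm_cong_iff by (auto simp: \<sigma>'_def)
  qed
  moreover have "occs (\<sigma>' x) = []" if "x \<in> set (occs t) \<union> vars_list (map fst ps)" for x
    using that \<sigma>(2) \<gamma>(2) by (auto simp: \<sigma>'_def occs_subst)
  moreover have "\<sigma>' x = Var x" if "x \<notin> set (occs t) \<union> vars_list (map fst ps)" for x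
    using that \<sigma>(3) by (simp add: \<sigma>'_def)
  ultimately show ?case
    using \<sigma>(1) p by (intro exI[of _ \<sigma>']) (auto simp: vars_list_eq)
qed

lemma types_nth:
  assumes "wf_program P" "wf_atom P a" "i < length (args a)"
  shows "is_type (types P (pred a) ! i)"
proof -
  have "types P (pred a) ! i \<in> set (types P (pred a))"
    using assms by (intro nth_mem) (simp add: wf_program_def wf_atom_def)
  then show ?thesis using assms(1) by (simp add: wf_program_def)
qed

lemma typed_out_subst:
  assumes "wf_program P" "wf_atom P a" "typed_out P a"
  shows "typed_out P (a \<cdot>a \<sigma>)"
  using assms types_nth[OF assms(1,2)] outpos_less[OF assms(2)]
  by (auto simp: typed_out_def is_type_def)

lemma typed_in_subst:
  assumes "wf_program P" "wf_atom P a" "typed_in P a"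
  shows "typed_in P (a \<cdot>a \<sigma>)"
  using assms types_nth[OF assms(1,2)] inpos_less[OF assms(2)]
  by (auto simp: typed_in_def is_type_def)

text \<open>Bound outputs are type-consistent by robust typing. Free outputs are variables, which
  are type-consistent because types are non-empty.\<close>

lemma outputs_type_instance:
  assumes wf: "wf_program P" and Q: "good_query P Q"
  shows "\<exists>\<sigma>. (\<forall>a \<in> set Q. typed_out P (a \<cdot>a \<sigma>)) \<and>
    (\<forall>x \<in> vars_list (outs P Q). occs (\<sigma> x) = []) \<and> (\<forall>x. x \<notin> vars_list (outs P Q) \<longrightarrow> \<sigma> x = Var x)"
proof -
  define ps where
    "ps = concat (map (\<lambda>a. nths (zip (args a) (types P (pred a))) (outpos P (pred a))) Q)"
  have wf_Q: "\<forall>a \<in> set Q. wf_atom P a" using Q by (simp add: good_query_def)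
  have len: "length (args a) = length (types P (pred a))" if "a \<in> set Q" for a
    using wf wf_Q that by (simp add: wf_program_def wf_atom_def)
  have "map (\<lambda>a. map fst (nths (zip (args a) (types P (pred a))) (outpos P (pred a)))) Q = map (out_args P) Q"
    using len by (simp add: out_args_def nths_map[symmetric])
  then have fst_ps: "map fst ps = outs P Q"
    unfolding ps_def map_concat map_map comp_def by (rule arg_cong)
  have "is_type T \<and> type_consistent t T" if tT: "(t, T) \<in> set ps" for t T
  proof -
    from tT obtain a i where a: "a \<in> set Q" "i < length (args a)" "i \<in> outpos P (pred a)"
      "t = args a ! i" "T = types P (pred a) ! i"
      using len by (auto simp: ps_def set_nths)
    have T: "is_type T" using types_nth[OF wf] wf_Q a by blast
    have "robust_pos P a i" using Q a by (auto simp: good_query_def robustly_typed_query_def)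
    moreover have "type_consistent (Var x) T" for x
    proof -
      obtain s where "s \<in> T" using T by (auto simp: is_type_def)
      then show ?thesis unfolding type_consistent_def by (intro exI[of _ "\<lambda>_. s"]) simp
    qed
    ultimately show ?thesis
      using T a by (auto simp: robust_pos_def is_variable_iff split: if_splits)
  qed
  moreover have "linear (outs P Q)"
    using Q by (simp add: good_query_def robustly_typed_query_def nicely_moded_query_iff)
  ultimately obtain \<sigma> where \<sigma>: "\<forall>(t, T) \<in> set ps. t \<cdot> \<sigma> \<in> T"
    "\<forall>x. x \<in> vars_list (outs P Q) \<longrightarrow> occs (\<sigma> x) = []"
    "\<forall>x. x \<notin> vars_list (outs P Q) \<longrightarrow> \<sigma> x = Var x"
    using linear_type_instance[of ps] unfolding fst_ps by blast
  have "typed_out P (a \<cdot>a \<sigma>)" if a: "a \<in> set Q" for a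
    unfolding typed_out_def
  proof
    fix i assume "i \<in> outpos P (pred (a \<cdot>a \<sigma>))"
    then have i: "i \<in> outpos P (pred a)" "i < length (args a)"
      using outpos_less[of P a] wf_Q a by auto
    have "(args a ! i, types P (pred a) ! i) \<in> set (nths (zip (args a) (types P (pred a))) (outpos P (pred a)))"
      using i len[OF a] unfolding set_nths by (intro CollectI exI[of _ i]) simp
    then have "(args a ! i, types P (pred a) ! i) \<in> set ps"
      using a by (auto simp: ps_def)
    then show "args (a \<cdot>a \<sigma>) ! i \<in> types P (pred (a \<cdot>a \<sigma>)) ! i"
      using \<sigma>(1) i(2) by auto
  qed
  then show ?thesis using \<sigma> by blast
qed

text \<open>A closing instance supplies the consumers \<open>B\<close> with correctly typed inputs in place of the
  values that the producers \<open>F\<close> have not computed yet.\<close>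

definition closing ::
  "('f, 'v, 'p) program \<Rightarrow> ('f, 'v, 'p) query \<Rightarrow> ('f, 'v, 'p) query \<Rightarrow> ('f, 'v) subst \<Rightarrow> bool" where
  "closing P F B \<delta> \<longleftrightarrow> (\<forall>a \<in> set F. typed_out P (a \<cdot>a \<delta>)) \<and>
    renames_apart \<delta> (vars_query B - vars_query F)"

lemma vars_outs_subset: "vars_list (outs P Q) \<subseteq> vars_query Q"
  using vars_out_subset[of P] unfolding vars_list_outs by (auto simp: vars_query_def)

lemma good_query_append:
  assumes "good_query P (F @ B)"
  shows "good_query P F"
proof -
  have nm: "nicely_moded_query P (F @ B)" and wt: "well_typed_query P (F @ B)"
    using assms by (simp_all add: good_query_def robustly_typed_query_def)
  have "nicely_moded_query P F"
    unfolding nicely_moded_query_iff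
  proof (intro conjI allI impI)
    show "linear (outs P F)" using nm by (simp add: nicely_moded_query_iff linear_append)
    fix A b C assume "F = A @ b # C"
    then have "vars_in P b \<inter> vars_list (outs P (b # C @ B)) = {}"
      using nm[unfolded nicely_moded_query_iff, THEN conjunct2, rule_format, of A b "C @ B"] by simp
    then show "vars_in P b \<inter> vars_list (outs P (b # C)) = {}" by auto
  qed
  moreover have "well_typed_query P F"
    unfolding well_typed_query_iff
  proof (intro allI impI)
    fix A b C \<sigma> assume "F = A @ b # C" "\<forall>c \<in> set A. typed_out P (c \<cdot>a \<sigma>)"
    then show "typed_in P (b \<cdot>a \<sigma>)"
      using wt[unfolded well_typed_query_iff, rule_format, of A b "C @ B" \<sigma>] by simp
  qed
  ultimately show ?thesis using assms by (simp add: good_query_def robustly_typed_query_def)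
qed

text \<open>Outputs of the producers receive typed ground values and all other variables stay, so
  the identity serves as the renaming of the variables that belong to the consumers alone.\<close>

lemma closing_exists:
  assumes "wf_program P" "good_query P (F @ B)"
  shows "\<exists>\<delta>. closing P F B \<delta>"
proof -
  obtain \<delta> where \<delta>: "\<forall>a \<in> set F. typed_out P (a \<cdot>a \<delta>)"
    "\<forall>x \<in> vars_list (outs P F). occs (\<delta> x) = []" "\<forall>x. x \<notin> vars_list (outs P F) \<longrightarrow> \<delta> x = Var x"
    using outputs_type_instance[OF assms(1) good_query_append[OF assms(2)]] by blast
  have "(\<lambda>x. x) ` (vars_query B - vars_query F) \<inter> set (occs (\<delta> z)) = {}"
    if "z \<notin> vars_query B - vars_query F" for z
    using that \<delta>(2,3) by (cases "z \<in> vars_list (outs P F)") auto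
  moreover have "\<delta> x = Var x" if "x \<in> vars_query B - vars_query F" for x
    using that \<delta>(3) vars_outs_subset[of P F] by blast
  ultimately show ?thesis
    using \<delta>(1) unfolding closing_def renames_apart_def
    by (intro exI[of _ \<delta>] conjI exI[of _ "\<lambda>x. x"]) auto
qed

text \<open>The mode condition forbids an output variable of a later atom in earlier inputs, and
  linearity forbids it in earlier outputs. Hence a closing substitution merely renames the outputs
  of the consumers.\<close>

lemma good_query_vars_disjoint:
  assumes "good_query P (F @ B)" "b \<in> set B"
  shows "vars_query F \<inter> vars_out P b = {}"
proof -
  have nm: "linear (outs P (F @ B))"
    "\<And>A b C. F @ B = A @ b # C \<Longrightarrow> vars_in P b \<inter> vars_list (outs P (b # C)) = {}"
    using assms(1) unfolding good_query_def robustly_typed_query_def nicely_moded_query_iff by blast+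
  have "vars_out P b \<subseteq> vars_list (outs P B)" using assms(2) unfolding vars_list_outs by blast
  moreover have "vars_atom f \<inter> vars_list (outs P B) = {}" if f: "f \<in> set F" for f
  proof -
    obtain X Y where F: "F = X @ f # Y" using f by (meson split_list)
    have "vars_in P f \<inter> vars_list (outs P B) = {}" using nm(2)[of X f "Y @ B"] F by auto
    moreover have "vars_out P f \<inter> vars_list (outs P B) = {}" using nm(1) F by (auto simp: linear_append)
    moreover have "wf_atom P f" using assms(1) f by (simp add: good_query_def)
    ultimately show ?thesis by (auto simp: vars_atom_eq)
  qed
  ultimately show ?thesis by (auto simp: vars_query_def)
qed

text \<open>Outputs of \<open>b\<close> are renamed injectively and kept off its instantiated
  inputs. The inputs are typed because the closed producers have typed outputs, and they remain so
  under further instantiation. Thus facts about robustly typed one-atom queries apply.\<close>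

lemma closing_good:
  assumes wf: "wf_program P" and Q: "good_query P (F @ [b])" and cl: "closing P F [b] \<delta>"
  shows "good_query P [b \<cdot>a \<delta>]"
proof -
  have wf_b: "wf_atom P b" and wf_F: "\<forall>f \<in> set F. wf_atom P f" using Q by (auto simp: good_query_def)
  have rt: "robustly_typed_query P (F @ [b])" using Q by (simp add: good_query_def)
  have nmq: "nicely_moded_query P (F @ [b])" using rt by (simp add: robustly_typed_query_def)
  have nm: "linear (out_args P b)" "vars_in P b \<inter> vars_out P b = {}"
    using nmq[unfolded nicely_moded_query_iff, THEN conjunct1]
      nmq[unfolded nicely_moded_query_iff, THEN conjunct2, rule_format, of F b "[]"]
    by (simp_all add: linear_append)
  have sub: "vars_out P b \<subseteq> vars_query [b] - vars_query F"
    using good_query_vars_disjoint[OF Q, of b] vars_out_subset[of P b] by auto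
  have "renames_apart \<delta> (vars_out P b)"
    using cl renames_apart_subset[OF _ sub] unfolding closing_def by blast
  then obtain \<rho> where \<rho>: "inj_on \<rho> (vars_out P b)" "\<forall>x \<in> vars_out P b. \<delta> x = Var (\<rho> x)"
    "\<forall>z. z \<notin> vars_out P b \<longrightarrow> \<rho> ` vars_out P b \<inter> set (occs (\<delta> z)) = {}"
    unfolding renames_apart_def by blast
  have "nicely_moded_query P [b \<cdot>a \<delta>]"
    unfolding nicely_moded_query_iff
  proof (intro conjI allI impI)
    show "linear (outs P [b \<cdot>a \<delta>])"
      using nm(1) \<rho>(1,2) by (auto intro!: linear_subst simp: inj_on_def)
    fix A c C assume "[b \<cdot>a \<delta>] = A @ c # C"
    then have c: "c = b \<cdot>a \<delta>" "C = []" by (auto simp: Cons_eq_append_conv)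
    have "vars_out P c = \<rho> ` vars_out P b"
      unfolding c out_args_subst vars_list_subst using \<rho>(2) by auto
    moreover have "vars_in P c \<inter> \<rho> ` vars_out P b = {}"
      unfolding c in_args_subst vars_list_subst using \<rho>(3) nm(2) by blast
    ultimately show "vars_in P c \<inter> vars_list (outs P (c # C)) = {}" using c by simp
  qed
  moreover have "well_typed_query P [b \<cdot>a \<delta>]"
    unfolding well_typed_query_iff
  proof (intro allI impI)
    fix A c C \<sigma> assume "[b \<cdot>a \<delta>] = A @ c # C"
    then have c: "c = b \<cdot>a \<delta>" by (auto simp: Cons_eq_append_conv)
    have "\<forall>f \<in> set F. typed_out P (f \<cdot>a subst_comp \<delta> \<sigma>)"
      using cl wf_F by (auto simp: closing_def subst_atom_comp intro: typed_out_subst[OF wf])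
    then have "typed_in P (b \<cdot>a subst_comp \<delta> \<sigma>)"
      using rt unfolding robustly_typed_query_def well_typed_query_iff by blast
    then show "typed_in P (c \<cdot>a \<sigma>)" by (simp add: c subst_atom_comp)
  qed
  moreover have "robust_pos P (b \<cdot>a \<delta>) i" if i: "i \<in> outpos P (pred b)" for i
  proof -
    have i_len: "i < length (args b)" using outpos_less[OF wf_b i] .
    obtain \<pi> where \<pi>: "bij \<pi>" "\<And>x. x \<in> vars_out P b \<Longrightarrow> \<pi> x = \<rho> x"
      using extend_to_bij[OF finite_vars_list \<rho>(1)] by metis
    have "set (occs (args b ! i)) \<subseteq> vars_out P b"
      using i wf_b by (auto simp: vars_list_eq set_out_args)
    then have "args b ! i \<cdot> \<delta> = args b ! i \<cdot> (\<lambda>x. Var (\<pi> x))"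
      unfolding subst_trm_cong_iff using \<rho>(2) \<pi>(2) by auto
    moreover have "robust_pos P (b \<cdot>a (\<lambda>x. Var (\<pi> x))) i"
      using rt i i_len \<pi>(1) by (intro robust_pos_rename) (auto simp: robustly_typed_query_def bij_is_inj)
    ultimately show ?thesis using i_len by (auto simp: robust_pos_def split: if_splits)
  qed
  ultimately show ?thesis
    using wf_b by (simp add: good_query_def robustly_typed_query_def)
qed

section \<open>Closing instances before and after a step\<close>

text \<open>Every closing instance of the consumers after a producer step is already one before it,
  so termination of all closing instances is inherited. The outputs of the resolved atom
  \<open>a\<close> are typed because typed outputs of \<open>Q1\<close> type its inputs, and the
  well typed clause passes this on to the head outputs.\<close>

lemma closing_producer_step:
  assumes P: "wf_program P" "robustly_typed_program P" "input_linear_program P"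
    and cs: "canonical_step P Q1 a (Q2 @ G) C h B \<mu>"
    and cl: "closing P ((Q1 @ B @ Q2) \<cdot>q \<mu>) (G \<cdot>q \<mu>) \<delta>"
  shows "closing P (Q1 @ a # Q2) G (subst_comp \<mu> \<delta>)"
proof -
  note cs' = cs[unfolded canonical_step_def]
  let ?F = "Q1 @ a # Q2"
  let ?F' = "(Q1 @ B @ Q2) \<cdot>q \<mu>"
  let ?\<sigma> = "subst_comp \<mu> \<delta>"
  let ?N = "vars_query G - vars_query ?F"
  have "robustly_typed_clause P (Clause h B)"
    using clause_variant(1)[OF P] cs' by blast
  then have wtc: "well_typed_clause P (Clause h B)" by (simp add: robustly_typed_clause_def)
  have wtq: "well_typed_query P (Q1 @ a # Q2 @ G)"
    using cs' by (auto simp: good_query_def robustly_typed_query_def)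
  have typed': "typed_out P (b \<cdot>a ?\<sigma>)" if "b \<in> set (Q1 @ B @ Q2)" for b
    using cl that unfolding closing_def subst_atom_comp by auto
  have "typed_in P (a \<cdot>a ?\<sigma>)"
    using wtq[unfolded well_typed_query_iff, rule_format, of Q1 a "Q2 @ G" ?\<sigma>] typed' by simp
  moreover have unif: "a \<cdot>a ?\<sigma> = h \<cdot>a ?\<sigma>" using cs' by (simp add: subst_atom_comp)
  ultimately have "typed_out P (h \<cdot>a ?\<sigma>)"
    using wtc typed' unfolding well_typed_clause_iff by auto
  then have typed: "\<forall>b \<in> set ?F. typed_out P (b \<cdot>a ?\<sigma>)" using typed' unif by auto
  let ?V = "vars_query (h # B)"
  \<comment> \<open>Variables that occur in the consumers alone are out of reach of the step, which
    involves only the selected producer and the clause.\<close>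
  have N_V: "?N \<inter> (vars_atom a \<union> ?V) = {}" using cs' by auto
  have \<mu>_range: "set (occs (\<mu> z)) \<subseteq> {z} \<union> vars_atom a \<union> ?V" for z
    using cs' by (cases "z \<in> vars_out P a \<union> ?V") auto
  have \<mu>_N: "\<mu> x = Var x" if "x \<in> ?N" for x
    using cs' N_V that vars_out_subset[of P a] by blast
  have N_\<mu>: "x \<notin> set (occs (\<mu> z))" if x: "x \<in> ?N" "z \<noteq> x" for x z
    using \<mu>_range[of z] N_V that by auto
  have "?N \<subseteq> vars_query (G \<cdot>q \<mu>) - vars_query ?F'"
  proof
    fix x assume x: "x \<in> ?N"
    have "x \<in> vars_query (G \<cdot>q \<mu>)"
      unfolding vars_query_subst using x \<mu>_N[OF x] by (intro UN_I[of x]) auto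
    moreover have "x \<notin> vars_query ?F'"
    proof -
      have "z \<noteq> x" if "z \<in> vars_query (Q1 @ B @ Q2)" for z using that x N_V by auto
      then show ?thesis unfolding vars_query_subst using N_\<mu>[OF x] by blast
    qed
    ultimately show "x \<in> vars_query (G \<cdot>q \<mu>) - vars_query ?F'" by blast
  qed
  then have "renames_apart \<delta> ?N"
    using cl renames_apart_subset unfolding closing_def by blast
  then obtain \<rho> where \<rho>: "inj_on \<rho> ?N" "\<forall>x \<in> ?N. \<delta> x = Var (\<rho> x)"
    "\<forall>z. z \<notin> ?N \<longrightarrow> \<rho> ` ?N \<inter> set (occs (\<delta> z)) = {}"
    unfolding renames_apart_def by blast
  have "\<rho> ` ?N \<inter> set (occs (?\<sigma> z)) = {}" if z: "z \<notin> ?N" for z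
  proof -
    have "y \<notin> ?N" if "y \<in> set (occs (\<mu> z))" for y
      using N_\<mu>[of y z] z that by blast
    then show ?thesis using \<rho>(3) by (fastforce simp: subst_comp_def occs_subst)
  qed
  moreover have "?\<sigma> x = Var (\<rho> x)" if "x \<in> ?N" for x
    using \<rho>(2) \<mu>_N that by (simp add: subst_comp_def)
  ultimately show ?thesis
    using typed \<rho>(1) unfolding closing_def renames_apart_def by blast
qed

text \<open>The forward direction makes a chosen closing instance follow the step, so it can serve
  as a termination measure. The backward direction shows that each closing instance of the new
  consumers is reached in one step from one of the old, so termination of all closing instances is
  inherited.\<close>

lemma closing_consumer_step:
  fixes P :: "('f, 'v::infinite, 'p) program"
  assumes cs: "canonical_step P (F @ G1) a G2 C h B \<mu>"
  defines "G \<equiv> G1 @ a # G2" and "G' \<equiv> (G1 @ B @ G2) \<cdot>q \<mu>"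
  shows "F \<cdot>q \<mu> = F"
    and "closing P F G \<delta> \<Longrightarrow> \<exists>\<delta>'. closing P F G' \<delta>' \<and> step P (G \<cdot>q \<delta>) (G' \<cdot>q \<delta>')"
    and "closing P F G' \<delta> \<Longrightarrow> \<exists>\<delta>'. closing P F G \<delta>' \<and> step P (G \<cdot>q \<delta>') (G' \<cdot>q \<delta>)"
proof -
  note cs' = cs[unfolded canonical_step_def]
  let ?V = "vars_query (h # B)"
  let ?N = "vars_query G - vars_query F"
  let ?N' = "vars_query G' - vars_query F"
  have Q: "good_query P (F @ G)" using cs' by (simp add: G_def)
  have F_a: "vars_query F \<inter> vars_out P a = {}"
    using good_query_vars_disjoint[OF Q] by (simp add: G_def)
  have V_Q: "?V \<inter> (vars_query F \<union> vars_query G) = {}" using cs' by (auto simp: G_def)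
  have \<mu>_range: "set (occs (\<mu> z)) \<subseteq> {z} \<union> vars_atom a \<union> ?V" for z
    using cs' by (cases "z \<in> vars_out P a \<union> ?V") auto
  \<comment> \<open>The variables moved by the step are outputs of the consumer \<open>a\<close>,
    which do not occur in \<open>F\<close>, and fresh clause variables. So \<open>\<mu>\<close>
    fixes \<open>F\<close>, and a closing substitution can be made to rename all of them
    apart.\<close>
  have T_N: "vars_out P a \<union> ?V \<subseteq> ?N \<union> ?V"
    using F_a vars_out_subset[of P a] by (auto simp: G_def)
  have "vars_query G' \<subseteq> vars_query G \<union> ?V"
    unfolding G'_def vars_query_subst using \<mu>_range by (fastforce simp: G_def)
  then have N'_sub: "?N' \<subseteq> ?N \<union> ?V" by blast
  show "F \<cdot>q \<mu> = F"
    using cs' F_a V_Q by (intro subst_query_id) blast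
  have fin: "finite ?N" "finite ?N'" "finite (vars_query F)" "finite ?V"
    by (simp_all add: finite_vars_query del: vars_query_simps)
  have typed_eq: "(\<forall>f \<in> set F. typed_out P (f \<cdot>a \<delta>')) \<longleftrightarrow> (\<forall>f \<in> set F. typed_out P (f \<cdot>a \<delta>))"
    if "\<forall>x \<in> vars_query F. \<delta>' x = \<delta> x" for \<delta> \<delta>' :: "('f, 'v) subst"
  proof -
    have "f \<cdot>a \<delta>' = f \<cdot>a \<delta>" if "f \<in> set F" for f
      unfolding subst_atom_cong_iff using \<open>\<forall>x \<in> vars_query F. \<delta>' x = \<delta> x\<close> that
      by (auto simp: vars_query_def)
    then show ?thesis by simp
  qed
  show "\<exists>\<delta>'. closing P F G' \<delta>' \<and> step P (G \<cdot>q \<delta>) (G' \<cdot>q \<delta>')" if cl: "closing P F G \<delta>"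
  proof -
    have "renames_apart \<delta> ?N" using cl by (simp add: closing_def)
    then obtain \<delta>' where \<delta>': "\<forall>x \<in> ?N \<union> vars_query F. \<delta>' x = \<delta> x" "renames_apart \<delta>' (?N \<union> ?V)"
      using renames_apart_extend[of \<delta> ?N "vars_query F" ?V] fin V_Q by blast
    have "G \<cdot>q \<delta>' = G \<cdot>q \<delta>" unfolding subst_query_cong_iff using \<delta>'(1) by blast
    moreover have "step P (G \<cdot>q \<delta>') (G' \<cdot>q \<delta>')"
      unfolding G_def G'_def by (rule canonical_step_subst[OF cs \<delta>'(2) T_N])
    moreover have "closing P F G' \<delta>'"
      unfolding closing_def
      using cl typed_eq[of \<delta>' \<delta>] \<delta>'(1) renames_apart_subset[OF \<delta>'(2) N'_sub]
      by (simp add: closing_def)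
    ultimately show ?thesis by auto
  qed
  show "\<exists>\<delta>'. closing P F G \<delta>' \<and> step P (G \<cdot>q \<delta>') (G' \<cdot>q \<delta>)" if cl: "closing P F G' \<delta>"
  proof -
    have "renames_apart \<delta> ?N'" using cl by (simp add: closing_def)
    \<comment> \<open>Going backward, \<open>G\<close> may contain variables that have vanished from
      \<open>G'\<close>, and the clause variables may have vanished too; all these are freshly
      renamed while the values on \<open>G'\<close> and \<open>F\<close> are kept.\<close>
    moreover have "(?N \<union> ?V) \<inter> vars_query F = {}" using V_Q by blast
    ultimately obtain \<delta>' where \<delta>': "\<forall>x \<in> ?N' \<union> vars_query F. \<delta>' x = \<delta> x"
      "renames_apart \<delta>' (?N' \<union> (?N \<union> ?V))"
      using renames_apart_extend[of \<delta> ?N' "vars_query F" "?N \<union> ?V"] fin by blast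
    have "G' \<cdot>q \<delta>' = G' \<cdot>q \<delta>" unfolding subst_query_cong_iff using \<delta>'(1) by blast
    moreover have "step P (G \<cdot>q \<delta>') (G' \<cdot>q \<delta>')"
      unfolding G_def G'_def using T_N by (intro canonical_step_subst[OF cs \<delta>'(2)]) blast
    moreover have "closing P F G \<delta>'"
      unfolding closing_def
      using cl typed_eq[of \<delta>' \<delta>] \<delta>'(1) renames_apart_subset[OF \<delta>'(2), of ?N]
      by (auto simp: closing_def)
    ultimately show ?thesis by auto
  qed
qed

text \<open>Lexicographic: the outer induction runs over the derivations of \<open>F\<close>, the
  inner one over the derivations of a single closing instance of \<open>G\<close>. The consumers are
  generalised in both, as steps on either side change them.\<close>

theorem terminating_append:
  fixes P :: "('f, 'v::infinite, 'p) program"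
  assumes P: "wf_program P" "robustly_typed_program P" "input_linear_program P" "input_selectability P"
    and F: "terminating P F" and Q: "good_query P (F @ G)"
    and G: "\<And>\<delta>. closing P F G \<delta> \<Longrightarrow> terminating P (G \<cdot>q \<delta>)"
  shows "terminating P (F @ G)"
  using F Q G
proof (induction F arbitrary: G rule: accp_induct_rule)
  case (1 F)
  note outer_IH = 1
  \<comment> \<open>\<open>X\<close> is one closing instance that serves as the inner measure; the
    last premise, on all closing instances, is what the outer hypothesis needs after a producer
    step, when another measure must be chosen.\<close>
  have inner: "terminating P (F @ G)"
    if "terminating P X" "X = G \<cdot>q \<delta>" "closing P F G \<delta>" "good_query P (F @ G)"
      "\<And>\<delta>. closing P F G \<delta> \<Longrightarrow> terminating P (G \<cdot>q \<delta>)" for X G \<delta>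
    using that
  proof (induction X arbitrary: G \<delta> rule: accp_induct_rule)
    case (1 X)
    note inner_IH = 1
    show ?case
    proof (rule terminatingI_canonical[OF P \<open>good_query P (F @ G)\<close>])
      fix Q1 a Q2 C h B \<mu>
      assume FG: "F @ G = Q1 @ a # Q2" and cs: "canonical_step P Q1 a Q2 C h B \<mu>"
      have good': "good_query P ((Q1 @ B @ Q2) \<cdot>q \<mu>)" using cs by (simp add: canonical_step_def)
      consider (producer) F2 where "F = Q1 @ a # F2" "Q2 = F2 @ G"
        | (consumer) G1 where "Q1 = F @ G1" "G = G1 @ a # Q2"
        using append_eq_append_Cons[OF FG] FG by auto
      then show "terminating P ((Q1 @ B @ Q2) \<cdot>q \<mu>)"
      proof cases
        case producer
        let ?F' = "(Q1 @ B @ F2) \<cdot>q \<mu>"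
        have cs': "canonical_step P Q1 a (F2 @ G) C h B \<mu>" using cs producer by simp
        have st: "step P F ?F'" using canonical_step_prefix[OF cs'] producer by simp
        have "terminating P (?F' @ G \<cdot>q \<mu>)"
        proof (rule outer_IH(2)[OF st])
          show "good_query P (?F' @ G \<cdot>q \<mu>)" using good' producer by simp
          fix \<delta> assume "closing P ?F' (G \<cdot>q \<mu>) \<delta>"
          then have "closing P F G (subst_comp \<mu> \<delta>)"
            using closing_producer_step[OF P(1-3) cs'] producer by simp
          then show "terminating P (G \<cdot>q \<mu> \<cdot>q \<delta>)"
            using inner_IH(6) by (metis subst_query_comp)
        qed
        then show ?thesis using producer by simp
      next
        case consumer
        let ?G' = "(G1 @ B @ Q2) \<cdot>q \<mu>"
        have cs': "canonical_step P (F @ G1) a Q2 C h B \<mu>" using cs consumer by simp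
        note cons = closing_consumer_step[OF cs', folded consumer(2)]
        have eq: "(Q1 @ B @ Q2) \<cdot>q \<mu> = F @ ?G'" using consumer cons(1) by simp
        obtain \<delta>' where \<delta>': "closing P F ?G' \<delta>'" "step P X (?G' \<cdot>q \<delta>')"
          using cons(2) inner_IH(3,4) by blast
        show ?thesis
          unfolding eq
        proof (rule inner_IH(2)[OF \<delta>'(2) refl \<delta>'(1)])
          show "good_query P (F @ ?G')" using good' eq by simp
          fix \<delta>'' assume "closing P F ?G' \<delta>''"
          then obtain \<delta>0 where "closing P F G \<delta>0" "step P (G \<cdot>q \<delta>0) (?G' \<cdot>q \<delta>'')"
            using cons(3) by blast
          then show "terminating P (?G' \<cdot>q \<delta>'')"
            using inner_IH(6) accp_downward by metis
        qed
      qed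
    qed
  qed
  \<comment> \<open>Existence is essential: without a closing instance the hypothesis on
    \<open>G\<close> would be vacuous and the inner induction would have no measure.\<close>
  obtain \<delta> where "closing P F G \<delta>" using closing_exists[OF P(1)] outer_IH(3) by blast
  then show ?case using inner[of "G \<cdot>q \<delta>" G \<delta>] outer_IH(3,4) by blast
qed

section \<open>Well-recurrent clauses\<close>

lemma level_subst:
  assumes wf: "wf_program P" and lev: "moded_typed_level_mapping P lev" and a: "a \<in> base_inp P"
  shows "lev (a \<cdot>a \<theta>) = lev a"
proof -
  let ?n = "length (args a)"
  \<comment> \<open>A level mapping may ignore outputs, or instantiate inputs while keeping outputs.
    The atom \<open>c\<close>, with instantiated inputs and the old outputs, is the halfway point
    that links \<open>a\<close> to \<open>a \<cdot>a \<theta>\<close>.\<close>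
  define c where "c = Atom (pred a)
    (map (\<lambda>i. if i \<in> inpos P (pred a) then args a ! i \<cdot> \<theta> else args a ! i) [0..<?n])"
  have nths_eq: "nths xs I = nths ys I"
    if "length xs = length ys" "\<And>i. i < length xs \<Longrightarrow> i \<in> I \<Longrightarrow> xs ! i = ys ! i" for xs ys :: "'d list" and I
    using that
  proof (induction xs ys arbitrary: I rule: list_induct2)
    case (Cons x xs y ys)
    have "nths xs {j. Suc j \<in> I} = nths ys {j. Suc j \<in> I}"
      using Cons.prems by (intro Cons.IH) (metis Suc_less_eq length_Cons mem_Collect_eq nth_Cons_Suc)
    then show ?case using Cons.prems[of 0] by (simp add: nths_Cons)
  qed simp
  have wf_a: "wf_atom P a" using a by (simp add: base_inp_def)
  have c: "pred c = pred a" "wf_atom P c" using wf_a by (simp_all add: c_def wf_atom_def)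
  have disj: "inpos P q \<inter> outpos P q = {}" for q by (auto simp: inpos_def outpos_def)
  have in_c: "in_args P c = map (\<lambda>t. t \<cdot> \<theta>) (in_args P a)"
    unfolding in_args_def nths_map[symmetric] c(1) by (rule nths_eq) (simp_all add: c_def)
  have out_c: "out_args P c = out_args P a"
    unfolding out_args_def c(1) using disj by (intro nths_eq) (auto simp: c_def)
  have a': "a \<cdot>a \<theta> \<in> base_inp P"
    using a typed_in_subst[OF wf wf_a] by (simp add: base_inp_def)
  have "lev a = lev c"
    using lev a c in_c out_c unfolding moded_typed_level_mapping_def by blast
  moreover have "lev (a \<cdot>a \<theta>) = lev c"
    using lev a' c in_c unfolding moded_typed_level_mapping_def by (metis in_args_subst subst_atom_simps(1))
  ultimately show ?thesis by simp
qed

theorem lemma5p9: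
  fixes P :: "('f, 'v::infinite, 'p) program"
    and p :: "'p predsym"
    and lev :: "('f, 'v, 'p) atom \<Rightarrow> nat"
  assumes "wf_program P"
    and "robustly_typed_program P"
    and "input_linear_program P"
    and "input_selectability P"
    and "p \<in> preds P"
    and "\<And>q. strictly_depends_on P p q \<Longrightarrow> robust P q"
    and "moded_typed_level_mapping P lev"
    and "\<And>C. C \<in> clauses P \<Longrightarrow> mutually_depend P (pred (head C)) p \<Longrightarrow> well_recurrent P lev C"
  shows "robust P p"
proof -
  note P = assms(1-4)
  \<comment> \<open>Claimed for all predicates equivalent to \<open>p\<close>, since the recursion
    may pass through any of them; one common level mapping provides the measure.\<close>
  have main: "terminating P [a]" if "mutually_depend P (pred a) p" "good_query P [a]" for a
    using that
  proof (induction "lev a" arbitrary: a rule: less_induct)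
    case less
    note md = less.prems(1) and good_a = less.prems(2)
    have wf_a: "wf_atom P a" using good_a by (simp add: good_query_def)
    have in_a: "typed_in P a"
      using good_a unfolding good_query_def robustly_typed_query_def well_typed_query_iff
      by (metis append_Nil empty_iff empty_set subst_atom_Var)
    show ?case
    proof (rule terminatingI_canonical[OF P good_a])
      fix Q1 a' Q2 C h B \<mu>
      assume "[a] = Q1 @ a' # Q2" and "canonical_step P Q1 a' Q2 C h B \<mu>"
      then have Q12: "Q1 = []" "Q2 = []" and "canonical_step P [] a [] C h B \<mu>"
        by (auto simp: Cons_eq_append_conv)
      note cs = this(3)[unfolded canonical_step_def]
      have C: "C \<in> clauses P" and var: "variant_of (Clause h B) C" and unif: "a \<cdot>a \<mu> = h \<cdot>a \<mu>"
        and good_B: "good_query P (B \<cdot>q \<mu>)"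
        using cs by auto
      note cl = clause_variant[OF P(1-3) C var]
      have pred_a: "pred a = pred h" using unif by (metis subst_atom_simps(1))
      have a_base: "a \<in> base_inp P" using wf_a in_a pred_a cl(5) by (simp add: base_inp_def)
      \<comment> \<open>Strictly lower predicates are robust by assumption; for equivalent ones the
        level of the closed body atom is below that of \<open>a\<close>.\<close>
      have atom: "terminating P [b \<cdot>a \<delta>]"
        if F: "good_query P (F @ [b])" and b: "b \<in> set (B \<cdot>q \<mu>)" and \<delta>: "closing P F [b] \<delta>" for F b \<delta>
      proof -
        have good: "good_query P [b \<cdot>a \<delta>]" using closing_good[OF P(1) F \<delta>] .
        then have wf_b: "wf_atom P (b \<cdot>a \<delta>)" and rt_b: "robustly_typed_query P [b \<cdot>a \<delta>]"
          by (simp_all add: good_query_def)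
        have "pred b \<in> pred ` set (body C)" using b cl(8) by auto
        then have "refers_to P (pred (head C)) (pred b)"
          using C unfolding refers_to_def by blast
        then have "depends_on P (pred a) (pred b)"
          unfolding depends_on_def pred_a cl(7) by blast
        then have p_b: "depends_on P p (pred b)"
          using md unfolding mutually_depend_def depends_on_def by (meson rtranclp_trans)
        show ?thesis
        proof (cases "depends_on P (pred b) p")
          case False
          then have "robust P (pred b)"
            using p_b assms(6) by (simp add: strictly_depends_on_def)
          then show ?thesis using wf_b rt_b unfolding robust_iff_terminating by simp
        next
          case True
          have md_b: "mutually_depend P (pred b) p" using True p_b by (simp add: mutually_depend_def)
          obtain \<rho> where \<rho>: "h = head C \<cdot>a (\<lambda>x. Var (\<rho> x))" "B = body C \<cdot>q (\<lambda>x. Var (\<rho> x))"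
            using var by (auto simp: variant_of_def)
          obtain b0 where b0: "b0 \<in> set (body C)" "b = b0 \<cdot>a (\<lambda>x. Var (\<rho> x)) \<cdot>a \<mu>"
            using b \<rho>(2) by auto
          \<comment> \<open>Well-recurrence speaks of the program clause itself, so the renaming of
            the variant, the unifier and the closing substitution are merged into one substitution
            of that clause. The head becomes an instance of \<open>a\<close>, whose level equals
            that of \<open>a\<close>.\<close>
          define \<theta> where "\<theta> = subst_comp (subst_comp (\<lambda>x. Var (\<rho> x)) \<mu>) \<delta>"
          have b_\<theta>: "b \<cdot>a \<delta> = b0 \<cdot>a \<theta>" by (simp add: b0(2) \<theta>_def subst_atom_comp)
          have h_\<theta>: "head C \<cdot>a \<theta> = a \<cdot>a subst_comp \<mu> \<delta>"
            by (simp add: \<theta>_def subst_atom_comp unif \<rho>(1))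
          have "typed_in P (b \<cdot>a \<delta>)"
            using rt_b unfolding robustly_typed_query_def well_typed_query_iff
            by (metis append_Nil empty_iff empty_set subst_atom_Var)
          then have "b0 \<cdot>a \<theta> \<in> base_inp P"
            using wf_b b cl(6) unfolding b_\<theta>[symmetric] by (auto simp: base_inp_def)
          moreover have "head C \<cdot>a \<theta> \<in> base_inp P"
            unfolding h_\<theta> using a_base typed_in_subst[OF P(1) wf_a] by (simp add: base_inp_def)
          moreover have "well_recurrent P lev C"
            using assms(8)[OF C] md pred_a cl(7) by simp
          moreover have "mutually_depend P (pred b0) (pred (head C))"
            using md md_b b0(2) pred_a cl(7) unfolding mutually_depend_def depends_on_def
            by (auto intro: rtranclp_trans)
          ultimately have "lev (b0 \<cdot>a \<theta>) < lev (head C \<cdot>a \<theta>)"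
            using b0(1) unfolding well_recurrent_def by blast
          also have "\<dots> = lev a" unfolding h_\<theta> by (rule level_subst[OF P(1) assms(7) a_base])
          finally have "lev (b \<cdot>a \<delta>) < lev a" using b_\<theta> by simp
          then show ?thesis using less.hyps md_b good by simp
        qed
      qed
      \<comment> \<open>Prefixes grow at the right end, so the new atom is the only consumer and the
        terminating prefix acts as its producers.\<close>
      have "terminating P F" if "B \<cdot>q \<mu> = F @ G" for F G
        using that
      proof (induction F arbitrary: G rule: rev_induct)
        case Nil
        show ?case
          by (rule accp.accI) (simp add: step_def deriv_step_def)
      next
        case (snoc b F)
        have good: "good_query P (F @ [b])"
          using good_B snoc.prems good_query_append[of P "F @ [b]" G] by simp
        have b: "b \<in> set (B \<cdot>q \<mu>)" unfolding snoc.prems by simp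
        show ?case
        proof (rule terminating_append[OF P _ good])
          show "terminating P F" using snoc.IH[of "b # G"] snoc.prems by simp
          show "terminating P ([b] \<cdot>q \<delta>)" if "closing P F [b] \<delta>" for \<delta>
            using atom[OF good b that] by simp
        qed
      qed
      then show "terminating P ((Q1 @ B @ Q2) \<cdot>q \<mu>)" using Q12 by simp
    qed
  qed
  have "mutually_depend P p p" by (simp add: mutually_depend_def depends_on_def)
  then show ?thesis
    unfolding robust_iff_terminating using main by (simp add: good_query_def)
qed

end
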